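(* Let $I$ and $J$ be disjoint subsets of $\mathbb N$, $v$ a value, $p_i\in[0,1]$ ($i\in I$), $q_j\in[0,1]$ ($j\in J$). Let $M$ be a well-formed network with $M\equiv N\mid\prod_{i\in I}m_i[\mathsf{snd}\langle v\rangle_{p_i}]^{\nu_{m_i}}\mid\prod_{j\in J}n_j[\mathsf{fwd}_{q_j}]^{\nu_{n_j}}$ such that for all $i\in I$: (1) $\{n_j : j\in J\}\subseteq\nu_{m_i}\subseteq\mathrm{nds}(M)$; (2) every node $k[P]^{\mu}$ of $N$ with $k\in\nu_{m_i}$ satisfies $\neg\mathrm{rcv}(P)$. Then $N\mid\prod_{i\in I}m_i[\mathsf{nil}]^{\nu_{m_i}}\mid\prod_{j\in J}n_j[\mathsf{resnd}\langle v\rangle_{q_j}]^{\nu_{n_j}}\ \sqsubseteq_r\ M$ with $r=\prod_{i\in I}(1-p_i)$.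
   Context: The process calculus pTCWS. Processes $P,Q$ and probabilistic choices $C,D$ are $P ::= \mathsf{nil} \mid {!}\langle u\rangle.C \mid \lfloor ?(x).C\rfloor D \mid \tau.C \mid \sigma.C \mid X \mid \mathsf{fix}\,X.P$ and $C ::= \bigoplus_{i\in I} p_i{:}P_i$ ($I$ finite non-empty, $p_i\in(0,1]$, $\sum_i p_i=1$); in $\mathsf{fix}\,X.P$ every occurrence of $X$ is time-guarded (under a $\sigma$-prefix or in a timeout branch $D$). $1{:}P$ is written $P$; $P\oplus_pQ$ is $p{:}P\oplus(1-p){:}Q$; ${!}\langle v\rangle$ is ${!}\langle v\rangle.\mathsf{nil}$; $?(x).C$ abbreviates $\mathsf{fix}\,X.\lfloor ?(x).C\rfloor X$ ($X$ not free in $C$). Networks: $M::=\mathbf 0\mid M_1\mid M_2\mid n[P]^\nu\mid\bot$, where $n[P]^\nu$ is a node named $n$ running closed process $P$ with neighbour set $\nu$, and $\bot$ is a stuck network; $\prod$ is iterated $\mid$; $\mathrm{nds}(M)$ is the set of node names. Structural congruence $\equiv$: least equivalence preserved by $\mid$, making $\mid$ a commutative monoid with unit $\mathbf 0$, with $n[\mathsf{fix}\,X.P]^\nu\equiv n[P\{\mathsf{fix}\,X.P/X\}]^\nu$. Well-formed: no node is its own neighbour, distinct names, symmetric neighbourhood, connected neighbour graph; all networks are well-formed. $\mathrm{rcv}(P)$ holds iff $n[P]^\nu\equiv n[\lfloor ?(x).C\rfloor D]^\nu$ for some $x,C,D$ (the node "can receive in the current round"). Semantics: $\mathcal D(\mathcal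 N)$ finite-support probability distributions on networks, $|\Delta|$ total mass of a sub-distribution, $\overline M$ Dirac; $[\![n[\bigoplus_i p_i{:}P_i]^\nu]\!]=\sum_ip_i\overline{n[P_i]^\nu}$; $(\Delta\mid\Theta)(M_1\mid M_2)=\Delta(M_1)\Theta(M_2)$. Transitions $M\xrightarrow{\lambda}\Delta$, $\lambda\in\{m!v\triangleright\nu, m?v,\tau,\sigma\}$, form the least relation closed under: (Snd) $m[{!}\langle v\rangle.C]^\nu\xrightarrow{m!v\triangleright\nu}[\![m[C]^\nu]\!]$; (Rcv) if $m\in\nu$: $n[\lfloor ?(x).C\rfloor D]^\nu\xrightarrow{m?v}[\![n[C\{v/x\}]^\nu]\!]$; $\mathbf 0\xrightarrow{m?v}\overline{\mathbf 0}$; (RcvEnb) if $\neg(m\in\nu\wedge\mathrm{rcv}(P))$ and $m\ne n$: $n[P]^\nu\xrightarrow{m?v}\overline{n[P]^\nu}$; (RcvPar) $M\xrightarrow{m?v}\Delta$, $N\xrightarrow{m?v}\Theta$ give $M\mid N\xrightarrow{m?v}\Delta\mid\Theta$; (Bcast) $M\xrightarrow{m!v\triangleright\nu}\Delta$, $N\xrightarrow{m?v}\Theta$ give $M\mid N\xrightarrow{m!v\triangleright(\nu\setminus\mathrm{nds}(N))}\Delta\mid\Theta$ (and symmetrically); (Tau) $m[\tau.C]^\nu\xrightarrow{\tau}[\![m[C]^\nu]\!]$; (TauPar) $M\xrightarrow{\tau}\Delta$ and $N$ not of the form $\bot\mid N'$ give $M\mid N\xrightarrow{\tau}\Delta\mid\overline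 N$ (and symmetrically); $\mathbf 0\xrightarrow{\sigma}\overline{\mathbf 0}$; $n[\mathsf{nil}]^\nu\xrightarrow{\sigma}\overline{n[\mathsf{nil}]^\nu}$; (Timeout) $n[\lfloor ?(x).C\rfloor D]^\nu\xrightarrow{\sigma}[\![n[D]^\nu]\!]$; (Sleep) $n[\sigma.C]^\nu\xrightarrow{\sigma}[\![n[C]^\nu]\!]$; ($\sigma$-Par) $M\xrightarrow{\sigma}\Delta$, $N\xrightarrow{\sigma}\Theta$ give $M\mid N\xrightarrow{\sigma}\Delta\mid\Theta$; (Rec) $n[P\{\mathsf{fix}\,X.P/X\}]^\nu\xrightarrow{\lambda}\Delta$ gives $n[\mathsf{fix}\,X.P]^\nu\xrightarrow{\lambda}\Delta$; (ShhSnd) $M\xrightarrow{m!v\triangleright\emptyset}\Delta$ gives $M\xrightarrow{\tau}\Delta$; (ObsSnd) $M\xrightarrow{m!v\triangleright\nu}\Delta$ with $\nu\ne\emptyset$ gives $M\xrightarrow{!v\triangleright\nu}\Delta$. $\bot$ has no transitions. $\alpha$ ranges over $!v\triangleright\nu$, $m?v$, $\sigma$, $\tau$. Weak transitions: $M\xrightarrow{\hat\tau}\Delta$ iff $M\xrightarrow{\tau}\Delta$ or $\Delta=\overline M$; for $\alpha\ne\tau$, $\xrightarrow{\hat\alpha}=\xrightarrow{\alpha}$. For $\Delta=\sum_{i\in I}p_i\overline{M_i}$, $\Delta\xrightarrow{\hat\alpha}\Theta$ iff for some non-empty $J\subseteq I$, $M_j\xrightarrow{\hat\alpha}\Theta_j$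 ($j\in J$), $M_i$ has no $\hat\alpha$-transition ($i\notin J$), and $\Theta=\sum_{j\in J}p_j\Theta_j$. $\overset{\hat\tau}{\Longrightarrow}$ is the reflexive-transitive closure of $\xrightarrow{\hat\tau}$; $\overset{\hat\alpha}{\Longrightarrow}=\overset{\hat\tau}{\Longrightarrow}\xrightarrow{\hat\alpha}\overset{\hat\tau}{\Longrightarrow}$ for $\alpha\neq\tau$. A pseudoquasimetric is $d:\mathcal N\times\mathcal N\to[0,1]$ with $d(M,M)=0$ and the triangle inequality. $\Omega(\Delta,\Theta)$ is the set of matchings (distributions on pairs with marginals $\Delta,\Theta$); $\mathcal K(d)(\Delta,\Theta)=\min_{\omega\in\Omega(\Delta,\Theta)}\sum\omega(M,N)d(M,N)$. A weak simulation quasimetric is a pseudoquasimetric $d$ such that whenever $d(M,N)<1$ and $M\xrightarrow{\alpha}\Delta$ there is $\Theta$ with $N\overset{\hat\alpha}{\Longrightarrow}\Theta$ and $\mathcal K(d)(\Delta,\Theta+(1-|\Theta|)\overline\bot)\le d(M,N)$. $\mathbf m$ denotes the least weak simulation quasimetric (it exists), and $M\sqsubseteq_pN$ iff $\mathbf m(M,N)\le p$. Gossip processes: $\mathsf{snd}\langle u\rangle_p=\tau.({!}\langle u\rangle\oplus_p\mathsf{nil})$, $\mathsf{resnd}\langle u\rangle_p=\sigma.\mathsf{snd}\langle u\rangle_p$, $\mathsf{fwd}_p=?(x).\mathsf{resnd}\langle x\rangle_p$. *)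

theory Defs
  imports Complex_Main
begin

section \<open>Syntax of pTCWS\<close>

text \<open>Value variables and process variables are natural numbers; node names are
natural numbers; the type of values is an arbitrary type 'v.\<close>

datatype 'v tm = Val 'v | Var nat

text \<open>Processes.  A probabilistic choice  (+)_i p_i:P_i  is a list of pairs (p_i, P_i).
PRcv x C D is the receiver with timeout  floor(?(x).C) D.\<close>
datatype 'v proc =
    PNil
  | PSnd "'v tm" "(real \<times> 'v proc) list"
  | PRcv nat "(real \<times> 'v proc) list" "(real \<times> 'v proc) list"
  | PTau "(real \<times> 'v proc) list"
  | PSigma "(real \<times> 'v proc) list"
  | PVar nat
  | PFix nat "'v proc"

type_synonym 'v choice = "(real \<times> 'v proc) list"

text \<open>Substitution of a value for a value variable (x binds in C of floor(?(x).C)D only).\<close>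
fun tsubst :: "'v \<Rightarrow> nat \<Rightarrow> 'v tm \<Rightarrow> 'v tm" where
  "tsubst v x (Val w) = Val w"
| "tsubst v x (Var y) = (if y = x then Val v else Var y)"

primrec vsubst :: "'v \<Rightarrow> nat \<Rightarrow> 'v proc \<Rightarrow> 'v proc" where
  "vsubst v x PNil = PNil"
| "vsubst v x (PSnd u C) = PSnd (tsubst v x u) (map (map_prod id (vsubst v x)) C)"
| "vsubst v x (PRcv y C D) =
     PRcv y (if y = x then C else map (map_prod id (vsubst v x)) C) (map (map_prod id (vsubst v x)) D)"
| "vsubst v x (PTau C) = PTau (map (map_prod id (vsubst v x)) C)"
| "vsubst v x (PSigma C) = PSigma (map (map_prod id (vsubst v x)) C)"
| "vsubst v x (PVar X) = PVar X"
| "vsubst v x (PFix X P) = PFix X (vsubst v x P)"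

text \<open>Substitution of a (closed) process for a process variable.\<close>
primrec psubst :: "'v proc \<Rightarrow> nat \<Rightarrow> 'v proc \<Rightarrow> 'v proc" where
  "psubst Q X PNil = PNil"
| "psubst Q X (PSnd u C) = PSnd u (map (map_prod id (psubst Q X)) C)"
| "psubst Q X (PRcv y C D) = PRcv y (map (map_prod id (psubst Q X)) C) (map (map_prod id (psubst Q X)) D)"
| "psubst Q X (PTau C) = PTau (map (map_prod id (psubst Q X)) C)"
| "psubst Q X (PSigma C) = PSigma (map (map_prod id (psubst Q X)) C)"
| "psubst Q X (PVar Y) = (if Y = X then Q else PVar Y)"
| "psubst Q X (PFix Y P) = (if Y = X then PFix Y P else PFix Y (psubst Q X P))"

text \<open>Free value variables and free process variables.\<close>
fun tvars :: "'v tm \<Rightarrow> nat set" where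
  "tvars (Val w) = {}"
| "tvars (Var y) = {y}"

primrec fvv :: "'v proc \<Rightarrow> nat set" where
  "fvv PNil = {}"
| "fvv (PSnd u C) = tvars u \<union> \<Union> (set (map snd (map (map_prod id fvv) C)))"
| "fvv (PRcv y C D) = (\<Union> (set (map snd (map (map_prod id fvv) C))) - {y}) \<union> \<Union> (set (map snd (map (map_prod id fvv) D)))"
| "fvv (PTau C) = \<Union> (set (map snd (map (map_prod id fvv) C)))"
| "fvv (PSigma C) = \<Union> (set (map snd (map (map_prod id fvv) C)))"
| "fvv (PVar X) = {}"
| "fvv (PFix X P) = fvv P"

primrec fpv :: "'v proc \<Rightarrow> nat set" where
  "fpv PNil = {}"
| "fpv (PSnd u C) = \<Union> (set (map snd (map (map_prod id fpv) C)))"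
| "fpv (PRcv y C D) = \<Union> (set (map snd (map (map_prod id fpv) C))) \<union> \<Union> (set (map snd (map (map_prod id fpv) D)))"
| "fpv (PTau C) = \<Union> (set (map snd (map (map_prod id fpv) C)))"
| "fpv (PSigma C) = \<Union> (set (map snd (map (map_prod id fpv) C)))"
| "fpv (PVar X) = {X}"
| "fpv (PFix X P) = fpv P - {X}"

definition closed_proc :: "'v proc \<Rightarrow> bool" where
  "closed_proc P \<longleftrightarrow> fvv P = {} \<and> fpv P = {}"

text \<open>tg X P: every free occurrence of X in P is time-guarded, i.e. lies under a
sigma-prefix or in the timeout branch D of a receiver.\<close>
primrec tg :: "nat \<Rightarrow> 'v proc \<Rightarrow> bool" where
  "tg X PNil = True"
| "tg X (PSnd u C) = list_all snd (map (map_prod id (tg X)) C)"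
| "tg X (PRcv y C D) = list_all snd (map (map_prod id (tg X)) C)"
| "tg X (PTau C) = list_all snd (map (map_prod id (tg X)) C)"
| "tg X (PSigma C) = True"
| "tg X (PVar Y) = (X \<noteq> Y)"
| "tg X (PFix Y P) = (X = Y \<or> tg X P)"

definition wf_choice_shape :: "'v choice \<Rightarrow> bool" where
  "wf_choice_shape C \<longleftrightarrow> C \<noteq> [] \<and> (\<forall>(p, P) \<in> set C. 0 < p \<and> p \<le> 1)
     \<and> sum_list (map fst C) = 1"

text \<open>Syntactic well-formedness of processes: choices are probability distributions
and every fix-bound variable is time-guarded.\<close>
primrec wf_proc :: "'v proc \<Rightarrow> bool" where
  "wf_proc PNil = True"
| "wf_proc (PSnd u C) = (wf_choice_shape C \<and> list_all snd (map (map_prod id wf_proc) C))"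
| "wf_proc (PRcv y C D) = (wf_choice_shape C \<and> list_all snd (map (map_prod id wf_proc) C)
                          \<and> wf_choice_shape D \<and> list_all snd (map (map_prod id wf_proc) D))"
| "wf_proc (PTau C) = (wf_choice_shape C \<and> list_all snd (map (map_prod id wf_proc) C))"
| "wf_proc (PSigma C) = (wf_choice_shape C \<and> list_all snd (map (map_prod id wf_proc) C))"
| "wf_proc (PVar X) = True"
| "wf_proc (PFix X P) = (tg X P \<and> wf_proc P)"

section \<open>Networks\<close>

datatype 'v net = Zero | Par "'v net" "'v net" | Node nat "'v proc" "nat set" | Bot

fun nodelist :: "'v net \<Rightarrow> (nat \<times> 'v proc \<times> nat set) list" where
  "nodelist Zero = []"
| "nodelist (Par M N) = nodelist M @ nodelist N"
| "nodelist (Node n P \<nu>) = [(n, P, \<nu>)]"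
| "nodelist Bot = []"

definition nds :: "'v net \<Rightarrow> nat set" where
  "nds M = set (map fst (nodelist M))"

text \<open>Structural congruence.\<close>
inductive scong :: "'v net \<Rightarrow> 'v net \<Rightarrow> bool" where
  sc_refl: "scong M M"
| sc_sym: "scong M N \<Longrightarrow> scong N M"
| sc_trans: "scong M N \<Longrightarrow> scong N L \<Longrightarrow> scong M L"
| sc_parL: "scong M M' \<Longrightarrow> scong (Par M N) (Par M' N)"
| sc_parR: "scong N N' \<Longrightarrow> scong (Par M N) (Par M N')"
| sc_comm: "scong (Par M N) (Par N M)"
| sc_assoc: "scong (Par (Par M N) L) (Par M (Par N L))"
| sc_unit: "scong (Par M Zero) M"
| sc_fix: "scong (Node n (PFix X P) \<nu>) (Node n (psubst (PFix X P) X P) \<nu>)"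

text \<open>Well-formed networks: closed well-formed processes, distinct names, no node is
its own neighbour, symmetric neighbourhoods, connected neighbour graph.\<close>
definition wf_net :: "'v net \<Rightarrow> bool" where
  "wf_net M \<longleftrightarrow>
     (\<forall>(n, P, \<nu>) \<in> set (nodelist M). closed_proc P \<and> wf_proc P \<and> n \<notin> \<nu>)
   \<and> distinct (map fst (nodelist M))
   \<and> (\<forall>(m, P, \<nu>) \<in> set (nodelist M). \<forall>(n, Q, \<mu>) \<in> set (nodelist M). m \<in> \<mu> \<longleftrightarrow> n \<in> \<nu>)
   \<and> (\<forall>a \<in> nds M. \<forall>b \<in> nds M.
        (a, b) \<in> ({(m, n). \<exists>P \<nu>. (m, P, \<nu>) \<in> set (nodelist M) \<and> n \<in> \<nu> \<and> n \<in> nds M})\<^sup>*)"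

definition Nets :: "'v net set" where
  "Nets = {M. wf_net M}"

text \<open>The node n[P]^nu can receive in the current round.\<close>
definition rcv :: "nat \<Rightarrow> nat set \<Rightarrow> 'v proc \<Rightarrow> bool" where
  "rcv n \<nu> P \<longleftrightarrow> (\<exists>x C D. scong (Node n P \<nu>) (Node n (PRcv x C D) \<nu>))"

section \<open>Distributions\<close>

text \<open>Finite-support (sub-)distributions are represented as functions into the reals.\<close>
type_synonym 'v dist = "'v net \<Rightarrow> real"

definition supp :: "('a \<Rightarrow> real) \<Rightarrow> 'a set" where
  "supp \<Delta> = {x. \<Delta> x \<noteq> 0}"

definition mass :: "('a \<Rightarrow> real) \<Rightarrow> real" where
  "mass \<Delta> = sum \<Delta> (supp \<Delta>)"

definition dirac :: "'v net \<Rightarrow> 'v dist" where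
  "dirac M = (\<lambda>N. if N = M then 1 else 0)"

text \<open>[[ n[(+)_i p_i:P_i]^nu ]]\<close>
definition cdist :: "nat \<Rightarrow> 'v choice \<Rightarrow> nat set \<Rightarrow> 'v dist" where
  "cdist n C \<nu> = (\<lambda>N. sum_list (map (\<lambda>(p, P). if N = Node n P \<nu> then p else 0) C))"

definition dpar :: "'v dist \<Rightarrow> 'v dist \<Rightarrow> 'v dist" where
  "dpar \<Delta> \<Theta> = (\<lambda>M. case M of Par M1 M2 \<Rightarrow> \<Delta> M1 * \<Theta> M2 | _ \<Rightarrow> 0)"

section \<open>Labelled transitions\<close>

text \<open>LSnd m v nu is m!v|>nu, LRcv m v is m?v, LObs v nu is !v|>nu.\<close>
datatype 'v lab = LSnd nat 'v "nat set" | LRcv nat 'v | LTau | LSigma | LObs 'v "nat set"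

inductive trans :: "'v net \<Rightarrow> 'v lab \<Rightarrow> 'v dist \<Rightarrow> bool" where
  Snd: "trans (Node m (PSnd (Val v) C) \<nu>) (LSnd m v \<nu>) (cdist m C \<nu>)"
| Rcv: "m \<in> \<nu> \<Longrightarrow> trans (Node n (PRcv x C D) \<nu>) (LRcv m v)
          (cdist n (map (map_prod id (vsubst v x)) C) \<nu>)"
| Rcv0: "trans Zero (LRcv m v) (dirac Zero)"
| RcvEnb: "\<not> (m \<in> \<nu> \<and> rcv n \<nu> P) \<Longrightarrow> m \<noteq> n \<Longrightarrow>
          trans (Node n P \<nu>) (LRcv m v) (dirac (Node n P \<nu>))"
| RcvPar: "trans M (LRcv m v) \<Delta> \<Longrightarrow> trans N (LRcv m v) \<Theta> \<Longrightarrow>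
          trans (Par M N) (LRcv m v) (dpar \<Delta> \<Theta>)"
| BcastL: "trans M (LSnd m v \<nu>) \<Delta> \<Longrightarrow> trans N (LRcv m v) \<Theta> \<Longrightarrow>
          trans (Par M N) (LSnd m v (\<nu> - nds N)) (dpar \<Delta> \<Theta>)"
| BcastR: "trans M (LSnd m v \<nu>) \<Delta> \<Longrightarrow> trans N (LRcv m v) \<Theta> \<Longrightarrow>
          trans (Par N M) (LSnd m v (\<nu> - nds N)) (dpar \<Theta> \<Delta>)"
| Tau: "trans (Node m (PTau C) \<nu>) LTau (cdist m C \<nu>)"
| TauParL: "trans M LTau \<Delta> \<Longrightarrow> \<not> (\<exists>N'. scong N (Par Bot N')) \<Longrightarrow>
          trans (Par M N) LTau (dpar \<Delta> (dirac N))"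
| TauParR: "trans M LTau \<Delta> \<Longrightarrow> \<not> (\<exists>N'. scong N (Par Bot N')) \<Longrightarrow>
          trans (Par N M) LTau (dpar (dirac N) \<Delta>)"
| Sig0: "trans Zero LSigma (dirac Zero)"
| SigNil: "trans (Node n PNil \<nu>) LSigma (dirac (Node n PNil \<nu>))"
| Timeout: "trans (Node n (PRcv x C D) \<nu>) LSigma (cdist n D \<nu>)"
| Sleep: "trans (Node n (PSigma C) \<nu>) LSigma (cdist n C \<nu>)"
| SigPar: "trans M LSigma \<Delta> \<Longrightarrow> trans N LSigma \<Theta> \<Longrightarrow>
          trans (Par M N) LSigma (dpar \<Delta> \<Theta>)"
| Rec: "trans (Node n (psubst (PFix X P) X P) \<nu>) l \<Delta> \<Longrightarrow> trans (Node n (PFix X P) \<nu>) l \<Delta>"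
| ShhSnd: "trans M (LSnd m v {}) \<Delta> \<Longrightarrow> trans M LTau \<Delta>"
| ObsSnd: "trans M (LSnd m v \<nu>) \<Delta> \<Longrightarrow> \<nu> \<noteq> {} \<Longrightarrow> trans M (LObs v \<nu>) \<Delta>"

text \<open>Observable actions alpha: !v|>nu, m?v, sigma, tau.\<close>
definition obs_lab :: "'v lab \<Rightarrow> bool" where
  "obs_lab a \<longleftrightarrow> (\<forall>m v \<nu>. a \<noteq> LSnd m v \<nu>)"

section \<open>Weak transitions\<close>

definition hat_trans :: "'v net \<Rightarrow> 'v lab \<Rightarrow> 'v dist \<Rightarrow> bool" where
  "hat_trans M a \<Delta> \<longleftrightarrow> (if a = LTau then trans M LTau \<Delta> \<or> \<Delta> = dirac M else trans M a \<Delta>)"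

text \<open>Lifting to (sub-)distributions, for some decomposition Delta = sum_i p_i Dirac(M_i).\<close>
definition lift_hat :: "'v dist \<Rightarrow> 'v lab \<Rightarrow> 'v dist \<Rightarrow> bool" where
  "lift_hat \<Delta> a \<Theta> \<longleftrightarrow>
    (\<exists>xs :: (real \<times> 'v net) list.
       (\<forall>(p, M) \<in> set xs. 0 < p)
     \<and> \<Delta> = (\<lambda>N. sum_list (map (\<lambda>(p, M). if N = M then p else 0) xs))
     \<and> (\<exists>J \<subseteq> {..<length xs}. J \<noteq> {} \<and>
          (\<exists>\<Theta>s. (\<forall>j \<in> J. hat_trans (snd (xs ! j)) a (\<Theta>s j))
              \<and> (\<forall>i \<in> {..<length xs} - J. \<not> (\<exists>\<Theta>'. hat_trans (snd (xs ! i)) a \<Theta>'))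
              \<and> \<Theta> = (\<lambda>N. \<Sum>j\<in>J. fst (xs ! j) * \<Theta>s j N))))"

definition weak_tau :: "'v dist \<Rightarrow> 'v dist \<Rightarrow> bool" where
  "weak_tau = (\<lambda>\<Delta> \<Theta>. lift_hat \<Delta> LTau \<Theta>)\<^sup>*\<^sup>*"

definition weak_trans :: "'v net \<Rightarrow> 'v lab \<Rightarrow> 'v dist \<Rightarrow> bool" where
  "weak_trans N a \<Theta> \<longleftrightarrow>
     (if a = LTau then weak_tau (dirac N) \<Theta>
      else (\<exists>\<Delta>1 \<Delta>2. weak_tau (dirac N) \<Delta>1 \<and> lift_hat \<Delta>1 a \<Delta>2 \<and> weak_tau \<Delta>2 \<Theta>))"

section \<open>Weak simulation quasimetrics\<close>

definition matching :: "('v net \<times> 'v net \<Rightarrow> real) \<Rightarrow> 'v dist \<Rightarrow> 'v dist \<Rightarrow> bool" where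
  "matching \<omega> \<Delta> \<Theta> \<longleftrightarrow> finite (supp \<omega>) \<and> (\<forall>x. 0 \<le> \<omega> x)
     \<and> (\<forall>M. \<Delta> M = (\<Sum>x\<in>supp \<omega>. if fst x = M then \<omega> x else 0))
     \<and> (\<forall>N. \<Theta> N = (\<Sum>x\<in>supp \<omega>. if snd x = N then \<omega> x else 0))"

definition kant :: "('v net \<Rightarrow> 'v net \<Rightarrow> real) \<Rightarrow> 'v dist \<Rightarrow> 'v dist \<Rightarrow> real" where
  "kant d \<Delta> \<Theta> = Inf {(\<Sum>x\<in>supp \<omega>. \<omega> x * d (fst x) (snd x)) | \<omega>. matching \<omega> \<Delta> \<Theta>}"

text \<open>Theta + (1 - |Theta|) Dirac(bot)\<close>
definition pad_bot :: "'v dist \<Rightarrow> 'v dist" where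
  "pad_bot \<Theta> = (\<lambda>N. \<Theta> N + (if N = Bot then 1 - mass \<Theta> else 0))"

definition pseudoquasimetric :: "('v net \<Rightarrow> 'v net \<Rightarrow> real) \<Rightarrow> bool" where
  "pseudoquasimetric d \<longleftrightarrow>
     (\<forall>M\<in>Nets. \<forall>N\<in>Nets. 0 \<le> d M N \<and> d M N \<le> 1)
   \<and> (\<forall>M\<in>Nets. d M M = 0)
   \<and> (\<forall>M\<in>Nets. \<forall>N\<in>Nets. \<forall>L\<in>Nets. d M N \<le> d M L + d L N)"

definition weak_sim_qmet :: "('v net \<Rightarrow> 'v net \<Rightarrow> real) \<Rightarrow> bool" where
  "weak_sim_qmet d \<longleftrightarrow> pseudoquasimetric d \<and>
     (\<forall>M\<in>Nets. \<forall>N\<in>Nets. d M N < 1 \<longrightarrow>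
        (\<forall>a \<Delta>. obs_lab a \<longrightarrow> trans M a \<Delta> \<longrightarrow>
           (\<exists>\<Theta>. weak_trans N a \<Theta> \<and> kant d \<Delta> (pad_bot \<Theta>) \<le> d M N)))"

text \<open>The least weak simulation quasimetric (pointwise infimum).\<close>
definition mqm :: "'v net \<Rightarrow> 'v net \<Rightarrow> real" where
  "mqm M N = Inf {d M N | d. weak_sim_qmet d}"

definition wsim_approx :: "'v net \<Rightarrow> real \<Rightarrow> 'v net \<Rightarrow> bool" where
  "wsim_approx M p N \<longleftrightarrow> mqm M N \<le> p"

section \<open>Gossip processes\<close>

text \<open>P (+)_p Q = p:P (+) (1-p):Q, read as 1:P if p = 1 and 1:Q if p = 0.\<close>
definition poplus :: "real \<Rightarrow> 'v proc \<Rightarrow> 'v proc \<Rightarrow> 'v choice" where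
  "poplus p P Q = (if p = 1 then [(1, P)] else if p = 0 then [(1, Q)] else [(p, P), (1 - p, Q)])"

definition gsnd :: "'v tm \<Rightarrow> real \<Rightarrow> 'v proc" where
  "gsnd u p = PTau (poplus p (PSnd u [(1, PNil)]) PNil)"

definition gresnd :: "'v tm \<Rightarrow> real \<Rightarrow> 'v proc" where
  "gresnd u p = PSigma [(1, gsnd u p)]"

text \<open>fwd_p = ?(x).resnd<x>_p = fix X. floor(?(x). resnd<x>_p) X, with x = 0, X = 0.\<close>
definition gfwd :: "real \<Rightarrow> 'v proc" where
  "gfwd p = PFix 0 (PRcv 0 [(1, gresnd (Var 0) p)] [(1, PVar 0)])"

text \<open>Iterated parallel composition over a finite index set (increasing order).\<close>
definition bigpar :: "nat set \<Rightarrow> (nat \<Rightarrow> 'v net) \<Rightarrow> 'v net" where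
  "bigpar I f = foldr (\<lambda>i acc. Par (f i) acc) (sorted_list_of_set I) Zero"

end

theory Submission
  imports Defs "HOL-Library.Multiset"
begin

text \<open>Transitions are defined on syntax, and \<open>M\<close> is known only up to congruence,
  so it need not literally take the steps of its parallel normal form. Every step is therefore
  carried across the bisimulation, and distributions are compared only through congruence-invariant
  test functions. The delicate case of the bisimulation is associativity: a broadcast may be
  silenced at an inner \<open>Par\<close>, and after reassociation the outer component must be shown
  to let it pass. The constant arises because one successful broadcast switches all forwarders at
  once, and later broadcasts find no listener. A run fails only if every sender chooses
  \<open>PNil\<close>, which has probability \<open>\<Prod>i\<in>I. 1 - p i\<close>. The list-based
  lifting of weak transitions raises one more difficulty: different branches take silent runs of
  different lengths, so one branch must be able to advance while the others idle.\<close>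

text \<open>Let \<open>L\<close> be the network on the left. Run the senders of \<open>M\<close> one after the other: a sender that
  decides to broadcast is heard by all the forwarders and by nobody else, and since its neighbours
  all belong to \<open>M\<close> the broadcast is silent. Hence \<open>M\<close> silently reaches, with probability at least
  \<open>1 - r\<close>, networks congruent to \<open>L\<close>. Structural congruence is a strong bisimulation on
  well-formed networks, so the function with value \<open>0\<close> on congruent networks, \<open>r\<close> on pairs
  congruent to \<open>(L, M)\<close> and \<open>1\<close> elsewhere is already a weak simulation quasimetric: what is reached
  with the remaining probability is charged the maximal distance \<open>1\<close>.\<close>

section \<open>Expectations\<close>

definition expect :: "('a \<Rightarrow> real) \<Rightarrow> ('a \<Rightarrow> real) \<Rightarrow> real" where
  "expect \<Delta> f = (\<Sum>x\<in>supp \<Delta>. \<Delta> x * f x)"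

lemma expect_superset:
  assumes "finite A" "supp \<Delta> \<subseteq> A"
  shows "expect \<Delta> f = (\<Sum>x\<in>A. \<Delta> x * f x)"
  unfolding expect_def using assms by (intro sum.mono_neutral_left) (auto simp: supp_def)

lemma supp_dirac: "supp (dirac M) = {M}"
  by (auto simp: supp_def dirac_def)

lemma expect_dirac [simp]: "expect (dirac M) f = f M"
  by (simp add: expect_def supp_dirac) (simp add: dirac_def)

lemma expect_one: "expect \<Delta> (\<lambda>_. 1) = mass \<Delta>"
  by (simp add: expect_def mass_def)

lemma supp_dpar: "supp (dpar \<Delta> \<Theta>) = (\<lambda>(a, b). Par a b) ` (supp \<Delta> \<times> supp \<Theta>)"
proof -
  have "dpar \<Delta> \<Theta> x \<noteq> 0 \<longleftrightarrow> x \<in> (\<lambda>(a, b). Par a b) ` (supp \<Delta> \<times> supp \<Theta>)" for x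
    by (cases x) (auto simp: supp_def dpar_def image_iff)
  then show ?thesis by (auto simp: supp_def)
qed

text \<open>Fubini: \<open>Par\<close> is injective, so the support of \<open>dpar\<close>
  corresponds to the product of the supports. Laws of parallel composition become laws of iterated
  sums.\<close>

lemma expect_dpar: "expect (dpar \<Delta> \<Theta>) f = expect \<Delta> (\<lambda>a. expect \<Theta> (\<lambda>b. f (Par a b)))"
proof -
  have inj: "inj_on (\<lambda>(a, b). Par a b) (supp \<Delta> \<times> supp \<Theta>)"
    by (auto simp: inj_on_def)
  show ?thesis
    unfolding expect_def supp_dpar sum.reindex[OF inj]
    by (simp add: sum_distrib_left sum.cartesian_product dpar_def mult.assoc case_prod_unfold)
qed

lemma dpar_dirac: "dpar (dirac M) (dirac N) = dirac (Par M N)"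
  by (auto simp: dpar_def dirac_def fun_eq_iff split: net.splits)

lemma supp_cdist: "supp (cdist n C \<nu>) \<subseteq> (\<lambda>(p, P). Node n P \<nu>) ` set C"
proof
  fix x assume "x \<in> supp (cdist n C \<nu>)"
  then have "cdist n C \<nu> x \<noteq> 0" by (simp add: supp_def)
  then show "x \<in> (\<lambda>(p, P). Node n P \<nu>) ` set C"
    by (induction C) (auto simp: cdist_def split: if_splits)
qed

lemma expect_cdist: "expect (cdist n C \<nu>) f = (\<Sum>(p, P)\<leftarrow>C. p * f (Node n P \<nu>))"
proof -
  \<comment> \<open>The index set \<open>A\<close> stays fixed during the induction, because the
    support of \<open>cdist\<close> changes with the list and a process may occur in it several
    times.\<close>
  have "(\<Sum>x\<in>A. cdist n C \<nu> x * f x) = (\<Sum>(p, P)\<leftarrow>C. p * f (Node n P \<nu>))"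
    if "finite A" "(\<lambda>(p, P). Node n P \<nu>) ` set C \<subseteq> A" for A
    using that(2)
  proof (induction C)
    case Nil
    then show ?case by (simp add: cdist_def)
  next
    case (Cons c C)
    obtain p P where c: "c = (p, P)" by force
    have "(\<Sum>x\<in>A. cdist n (c # C) \<nu> x * f x)
        = (\<Sum>x\<in>A. (if x = Node n P \<nu> then p * f x else 0) + cdist n C \<nu> x * f x)"
      by (intro sum.cong) (auto simp: cdist_def c algebra_simps)
    then show ?case using Cons \<open>finite A\<close> by (simp add: c sum.distrib)
  qed
  from this[of "(\<lambda>(p, P). Node n P \<nu>) ` set C"] show ?thesis
    by (simp add: expect_superset[OF _ supp_cdist])
qed

lemma cdist_singleton: "cdist n [(1, P)] \<nu> = dirac (Node n P \<nu>)"
  by (auto simp: cdist_def dirac_def)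

definition prob :: "('a \<Rightarrow> real) \<Rightarrow> bool" where
  "prob \<Delta> \<longleftrightarrow> finite (supp \<Delta>) \<and> (\<forall>x. 0 \<le> \<Delta> x) \<and> mass \<Delta> = 1"

lemma prob_dirac: "prob (dirac M)"
  unfolding prob_def expect_one[symmetric] by (simp add: supp_dirac) (simp add: dirac_def)

lemma prob_dpar:
  assumes "prob \<Delta>" "prob \<Theta>" shows "prob (dpar \<Delta> \<Theta>)"
  using assms unfolding prob_def expect_one[symmetric] expect_dpar supp_dpar
  by (auto simp: dpar_def split: net.splits)

lemma prob_cdist:
  assumes "wf_choice_shape C" shows "prob (cdist n C \<nu>)"
proof -
  have "0 \<le> cdist n C \<nu> x" for x
    using assms unfolding cdist_def wf_choice_shape_def by (intro sum_list_nonneg) auto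
  moreover have "mass (cdist n C \<nu>) = 1"
    using assms by (simp add: expect_one[symmetric] expect_cdist wf_choice_shape_def case_prod_unfold)
  ultimately show ?thesis
    unfolding prob_def using finite_subset[OF supp_cdist] by blast
qed

text \<open>Lifting of structural congruence to distributions, phrased with invariant observables so that
  transitivity and compatibility with \<open>dpar\<close> need no gluing of matchings.\<close>

definition dist_eq :: "'v dist \<Rightarrow> 'v dist \<Rightarrow> bool" where
  "dist_eq \<Delta> \<Theta> \<longleftrightarrow> (\<forall>f. (\<forall>x y. scong x y \<longrightarrow> f x = f y) \<longrightarrow> expect \<Delta> f = expect \<Theta> f)"

lemma dist_eq_refl: "dist_eq \<Delta> \<Delta>"
  and dist_eq_sym: "dist_eq \<Delta> \<Theta> \<Longrightarrow> dist_eq \<Theta> \<Delta>"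
  and dist_eq_trans: "dist_eq \<Delta> \<Theta> \<Longrightarrow> dist_eq \<Theta> \<Psi> \<Longrightarrow> dist_eq \<Delta> \<Psi>"
  unfolding dist_eq_def by auto

lemma dist_eq_dirac: "scong M N \<Longrightarrow> dist_eq (dirac M) (dirac N)"
  by (simp add: dist_eq_def)

lemma expect_swap: "expect \<Delta> (\<lambda>a. expect \<Theta> (\<lambda>b. f a b)) = expect \<Theta> (\<lambda>b. expect \<Delta> (\<lambda>a. f a b))"
  unfolding expect_def sum_distrib_left
  by (subst sum.swap) (simp add: mult.left_commute)

lemma dist_eq_dpar_comm: "dist_eq (dpar \<Delta> \<Theta>) (dpar \<Theta> \<Delta>)"
  unfolding dist_eq_def
proof (intro allI impI)
  fix f :: "'a net \<Rightarrow> real" assume "\<forall>x y. scong x y \<longrightarrow> f x = f y"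
  then have "f (Par a b) = f (Par b a)" for a b using sc_comm by blast
  then show "expect (dpar \<Delta> \<Theta>) f = expect (dpar \<Theta> \<Delta>) f"
    unfolding expect_dpar by (subst expect_swap) simp
qed

lemma dist_eq_dpar_assoc: "dist_eq (dpar (dpar \<Delta> \<Theta>) \<Psi>) (dpar \<Delta> (dpar \<Theta> \<Psi>))"
  unfolding dist_eq_def
proof (intro allI impI)
  fix f :: "'a net \<Rightarrow> real" assume "\<forall>x y. scong x y \<longrightarrow> f x = f y"
  then have "f (Par (Par a b) c) = f (Par a (Par b c))" for a b c using sc_assoc by blast
  then show "expect (dpar (dpar \<Delta> \<Theta>) \<Psi>) f = expect (dpar \<Delta> (dpar \<Theta> \<Psi>)) f"
    unfolding expect_dpar by simp
qed

lemma dist_eq_dpar_unit: "dist_eq (dpar \<Delta> (dirac Zero)) \<Delta>"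
  unfolding dist_eq_def
proof (intro allI impI)
  fix f :: "'a net \<Rightarrow> real" assume "\<forall>x y. scong x y \<longrightarrow> f x = f y"
  then have "f (Par a Zero) = f a" for a using sc_unit by blast
  then show "expect (dpar \<Delta> (dirac Zero)) f = expect \<Delta> f"
    unfolding expect_dpar by simp
qed

text \<open>Averaging an invariant observable over the second component leaves an invariant
  observable of the first.\<close>

lemma dist_eq_dparL: "dist_eq \<Delta> \<Delta>' \<Longrightarrow> dist_eq (dpar \<Delta> \<Theta>) (dpar \<Delta>' \<Theta>)"
  unfolding dist_eq_def expect_dpar
proof (intro allI impI)
  fix f :: "'a net \<Rightarrow> real"
  assume *: "\<forall>f. (\<forall>x y. scong x y \<longrightarrow> f x = f y) \<longrightarrow> expect \<Delta> f = expect \<Delta>' f"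
    and "\<forall>x y. scong x y \<longrightarrow> f x = f y"
  then have "f (Par a b) = f (Par a' b)" if "scong a a'" for a a' b
    using that sc_parL by blast
  then show "expect \<Delta> (\<lambda>a. expect \<Theta> (\<lambda>b. f (Par a b))) = expect \<Delta>' (\<lambda>a. expect \<Theta> (\<lambda>b. f (Par a b)))"
    by (intro *[rule_format]) simp
qed

section \<open>Invariants of structural congruence\<close>

lemma scong_eqL: "scong M N \<Longrightarrow> scong M L = scong N L"
  using sc_trans[of M N L] sc_trans[OF sc_sym, of M N L] by (rule iffI[rotated])

section \<open>Stuck networks\<close>

primrec has_bot :: "'v net \<Rightarrow> bool" where
  "has_bot Zero = False"
| "has_bot (Par M N) = (has_bot M \<or> has_bot N)"
| "has_bot (Node n P \<nu>) = False"
| "has_bot Bot = True"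

lemma scong_has_bot: "scong M N \<Longrightarrow> has_bot M = has_bot N"
  by (induction rule: scong.induct) auto

lemma has_bot_scong: "has_bot M \<Longrightarrow> \<exists>M'. scong M (Par Bot M')"
proof (induction M)
  case (Par M N)
  have *: "\<exists>L. scong (Par A B) (Par Bot L)" if "scong A (Par Bot A')" for A A' B
    using that by (meson sc_assoc sc_parL sc_trans)
  show ?case
  proof (cases "has_bot M")
    case True
    then show ?thesis using Par.IH(1) * by blast
  next
    case False
    then have "has_bot N" using Par.prems by simp
    then show ?thesis using Par.IH(2) * by (meson sc_comm sc_trans)
  qed
qed (auto intro: sc_sym sc_unit)

text \<open>Turns the side condition of \<open>TauParL\<close> and \<open>TauParR\<close>, an
  existential over congruent networks, into a syntactic check that can be computed through
  \<open>Par\<close>.\<close>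

lemma scong_Par_Bot_iff: "(\<exists>M'. scong M (Par Bot M')) \<longleftrightarrow> has_bot M"
  using has_bot_scong scong_has_bot by fastforce

text \<open>Except for silent steps, a parallel composition moves only if both components do, and
  \<open>Bot\<close> has no move; the silent rules exclude an idle \<open>Bot\<close>.\<close>

lemma has_bot_stuck: "trans M l \<Delta> \<Longrightarrow> \<not> has_bot M"
  by (induction rule: trans.induct) (auto simp: scong_Par_Bot_iff)

text \<open>The recursion passes through \<open>PFix\<close>, which makes the head stable under unfolding.\<close>

primrec head_kind :: "'v proc \<Rightarrow> nat" where
  "head_kind PNil = 0"
| "head_kind (PSnd u C) = 1"
| "head_kind (PRcv x C D) = 2"
| "head_kind (PTau C) = 3"
| "head_kind (PSigma C) = 4"
| "head_kind (PVar X) = 5"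
| "head_kind (PFix X P) = head_kind P"

text \<open>Meant for \<open>Q = PFix X P\<close>, whose head is that of \<open>P\<close> by
  definition; the hypothesis settles the case where \<open>P\<close> is headed by \<open>X\<close>
  itself.\<close>

lemma head_kind_psubst: "head_kind Q = head_kind P \<Longrightarrow> head_kind (psubst Q X P) = head_kind P"
  by (induction P) auto

section \<open>Closedness and well-formedness under unfolding\<close>

lemma proc_induct [case_names PNil PSnd PRcv PTau PSigma PVar PFix]:
  assumes "Q PNil"
    and "\<And>u C. (\<And>c. c \<in> set C \<Longrightarrow> Q (snd c)) \<Longrightarrow> Q (PSnd u C)"
    and "\<And>x C D. (\<And>c. c \<in> set C \<Longrightarrow> Q (snd c)) \<Longrightarrow> (\<And>c. c \<in> set D \<Longrightarrow> Q (snd c)) \<Longrightarrow> Q (PRcv x C D)"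
    and "\<And>C. (\<And>c. c \<in> set C \<Longrightarrow> Q (snd c)) \<Longrightarrow> Q (PTau C)"
    and "\<And>C. (\<And>c. c \<in> set C \<Longrightarrow> Q (snd c)) \<Longrightarrow> Q (PSigma C)"
    and "\<And>X. Q (PVar X)"
    and "\<And>X P. Q P \<Longrightarrow> Q (PFix X P)"
  shows "Q P"
  by (induction P) (simp_all add: assms prod_set_defs)

lemma fvv_psubst1: "fvv P \<subseteq> fvv (psubst Q X P)"
proof (induction P rule: proc_induct)
  case (PRcv x C D)
  then show ?case by simp blast
next
  case (PSnd u C)
  then show ?case by simp blast
qed (simp_all, blast+)

lemma fvv_psubst2: "fvv (psubst Q X P) \<subseteq> fvv P \<union> fvv Q"
proof (induction P rule: proc_induct)
  case (PRcv x C D)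
  then show ?case by simp blast
next
  case (PSnd u C)
  then show ?case by simp blast
qed (simp_all, blast+)

lemma fpv_psubst1: "fpv P - {X} \<subseteq> fpv (psubst Q X P)"
proof (induction P rule: proc_induct)
  case (PRcv x C D)
  then show ?case by simp blast
next
  case (PSnd u C)
  then show ?case by simp blast
next
  case (PTau C)
  then show ?case by simp blast
next
  case (PSigma C)
  then show ?case by simp blast
next
  case (PFix Y P)
  then show ?case by auto
qed simp_all

lemma fpv_psubst2: "fpv (psubst Q X P) \<subseteq> (fpv P - {X}) \<union> fpv Q"
proof (induction P rule: proc_induct)
  case (PRcv x C D)
  then show ?case by simp blast
next
  case (PSnd u C)
  then show ?case by simp blast
next
  case (PTau C)
  then show ?case by simp blast
next
  case (PSigma C)
  then show ?case by simp blast
next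
  case (PFix Y P)
  then show ?case by auto
qed simp_all

lemma tg_notin_fpv: "X \<notin> fpv P \<Longrightarrow> tg X P"
  by (induction P rule: proc_induct) (auto simp: list_all_iff)

lemma tg_psubst: "fpv Q = {} \<Longrightarrow> tg Y P \<Longrightarrow> tg Y (psubst Q X P)"
  by (induction P rule: proc_induct) (auto simp: list_all_iff tg_notin_fpv)

lemma tg_psubstD: "tg Y (psubst Q X P) \<Longrightarrow> Y \<noteq> X \<Longrightarrow> tg Y P"
  by (induction P rule: proc_induct) (auto simp: list_all_iff split: if_splits)

lemma wf_choice_shape_map [simp]:
  "wf_choice_shape (map (map_prod id f) C) = wf_choice_shape C"
  by (auto simp: wf_choice_shape_def comp_def)

lemma wf_proc_psubst: "fpv Q = {} \<Longrightarrow> wf_proc Q \<Longrightarrow> wf_proc P \<Longrightarrow> wf_proc (psubst Q X P)"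
  by (induction P rule: proc_induct) (auto simp: list_all_iff tg_psubst)

lemma wf_proc_psubstD: "wf_proc (psubst Q X P) \<Longrightarrow> wf_proc P"
  by (induction P rule: proc_induct) (auto simp: list_all_iff dest: tg_psubstD split: if_splits)

text \<open>A free occurrence of \<open>X\<close> turns into a copy of \<open>Q\<close>, and
  \<open>wf_proc\<close> inspects that copy wherever it lands.\<close>

lemma wf_proc_psubstD2: "wf_proc (psubst Q X P) \<Longrightarrow> X \<in> fpv P \<Longrightarrow> wf_proc Q"
  by (induction P rule: proc_induct) (auto simp: list_all_iff split: if_splits)

definition good_proc :: "'v proc \<Rightarrow> bool" where
  "good_proc P \<longleftrightarrow> closed_proc P \<and> wf_proc P"

text \<open>An equality and not mere preservation, since congruence folds recursions as well as
  unfolding them.\<close>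

lemma good_proc_unfold: "good_proc (psubst (PFix X P) X P) = good_proc (PFix X P)"
proof -
  let ?Q = "PFix X P"
  have v: "fvv (psubst ?Q X P) = fvv ?Q" using fvv_psubst1[of P ?Q X] fvv_psubst2[of ?Q X P] by auto
  have p: "fpv (psubst ?Q X P) = fpv ?Q" using fpv_psubst1[of P X ?Q] fpv_psubst2[of ?Q X P] by auto
  have "wf_proc (psubst ?Q X P) = wf_proc ?Q" if "fpv ?Q = {}"
  proof
    assume "wf_proc (psubst ?Q X P)"
    \<comment> \<open>If \<open>X\<close> is free in \<open>P\<close>, the unfolding contains a copy
      of the recursion and thus its time-guardedness; otherwise \<open>X\<close> is guarded
      vacuously.\<close>
    then show "wf_proc ?Q"
      using wf_proc_psubstD2[of ?Q X P] wf_proc_psubstD[of ?Q X P] tg_notin_fpv[of X P] by auto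
  next
    assume "wf_proc ?Q"
    then show "wf_proc (psubst ?Q X P)" using wf_proc_psubst[OF that] by simp
  qed
  then show ?thesis using v p by (auto simp: good_proc_def closed_proc_def)
qed

text \<open>Congruence permutes nodes and unfolds recursions, so a multiset of data stable under
  unfolding is invariant. The head refutes readiness to receive and separates networks; the goodness
  flag transports well-formedness.\<close>

definition signature :: "'v net \<Rightarrow> (nat \<times> nat \<times> bool \<times> nat set) multiset" where
  "signature M = mset (map (\<lambda>(n, P, \<nu>). (n, head_kind P, good_proc P, \<nu>)) (nodelist M))"

lemma scong_signature: "scong M N \<Longrightarrow> signature M = signature N"
  by (induction rule: scong.induct) (auto simp: signature_def head_kind_psubst good_proc_unfold)

text \<open>Readiness to receive means congruence to a receiver, and congruence keeps the
  head.\<close>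

lemma not_rcv: "head_kind P \<noteq> 2 \<Longrightarrow> \<not> rcv n \<nu> P"
  by (auto simp: rcv_def dest!: scong_signature) (simp add: signature_def)

section \<open>Network topology\<close>

definition shape :: "'v net \<Rightarrow> (nat \<times> nat set) multiset" where
  "shape M = mset (map (\<lambda>(n, P, \<nu>). (n, \<nu>)) (nodelist M))"

lemma shape_signature: "shape M = image_mset (\<lambda>(n, h, g, \<nu>). (n, \<nu>)) (signature M)"
  by (simp add: shape_def signature_def case_prod_unfold comp_def multiset.map_comp)

lemma scong_shape: "scong M N \<Longrightarrow> shape M = shape N"
  by (simp add: shape_signature scong_signature)

lemma shape_nds: "nds M = fst ` set_mset (shape M)"
  by (force simp: nds_def shape_def)

lemma scong_nds: "scong M N \<Longrightarrow> nds M = nds N"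
  by (simp add: shape_nds scong_shape)

text \<open>The part of topological well-formedness that components inherit: connectedness is left
  out, because a component of a connected network may be disconnected. Distinctness of names is
  phrased by multiplicities so that everything depends on \<open>shape\<close> alone.\<close>

definition ok_net :: "'v net \<Rightarrow> bool" where
  "ok_net M \<longleftrightarrow> (\<forall>n \<nu>. (n, \<nu>) \<in># shape M \<longrightarrow> n \<notin> \<nu>)
    \<and> (\<forall>k. count (image_mset fst (shape M)) k \<le> 1)
    \<and> (\<forall>m \<nu> n \<mu>. (m, \<nu>) \<in># shape M \<longrightarrow> (n, \<mu>) \<in># shape M \<longrightarrow> m \<in> \<mu> \<longleftrightarrow> n \<in> \<nu>)"

lemma in_shape_iff: "(n, \<nu>) \<in># shape M \<longleftrightarrow> (\<exists>P. (n, P, \<nu>) \<in> set (nodelist M))"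
  by (force simp: shape_def)

lemma wf_net_alt:
  "wf_net M \<longleftrightarrow> (\<forall>(n, P, \<nu>) \<in> set (nodelist M). good_proc P) \<and> ok_net M
    \<and> (\<forall>a \<in> nds M. \<forall>b \<in> nds M.
        (a, b) \<in> ({(m, n). \<exists>\<nu>. (m, \<nu>) \<in># shape M \<and> n \<in> \<nu> \<and> n \<in> nds M})\<^sup>*)"
proof -
  have "mset (map fst (nodelist M)) = image_mset fst (shape M)"
    by (simp add: shape_def case_prod_unfold comp_def multiset.map_comp)
  then have "count (image_mset fst (shape M)) k = count (mset (map fst (nodelist M))) k" for k
    by simp
  moreover have "(count (mset xs) k = (if k \<in> set xs then 1 else 0)) \<longleftrightarrow> count (mset xs) k \<le> 1"
    for xs :: "nat list" and k
  proof (cases "k \<in> set xs")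
    case True
    then have "0 < count (mset xs) k" by simp
    then show ?thesis unfolding if_P[OF True] by linarith
  next
    case False
    then have "count (mset xs) k = 0" by simp
    then show ?thesis unfolding if_not_P[OF False] by linarith
  qed
  ultimately have d: "distinct (map fst (nodelist M)) \<longleftrightarrow> (\<forall>k. count (image_mset fst (shape M)) k \<le> 1)"
    unfolding distinct_count_atmost_1 by (simp only:)
  have e: "{(m, n). \<exists>P \<nu>. (m, P, \<nu>) \<in> set (nodelist M) \<and> n \<in> \<nu> \<and> n \<in> nds M}
    = {(m, n). \<exists>\<nu>. (m, \<nu>) \<in># shape M \<and> n \<in> \<nu> \<and> n \<in> nds M}"
    by (auto simp: in_shape_iff)
  have s: "(\<forall>(m, P, \<nu>) \<in> set (nodelist M). \<forall>(n, Q, \<mu>) \<in> set (nodelist M). m \<in> \<mu> \<longleftrightarrow> n \<in> \<nu>)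
    \<longleftrightarrow> (\<forall>m \<nu> n \<mu>. (m, \<nu>) \<in># shape M \<longrightarrow> (n, \<mu>) \<in># shape M \<longrightarrow> m \<in> \<mu> \<longleftrightarrow> n \<in> \<nu>)"
    unfolding in_shape_iff Ball_def split_paired_All case_prod_conv by blast
  have n: "(\<forall>(n, P, \<nu>) \<in> set (nodelist M). closed_proc P \<and> wf_proc P \<and> n \<notin> \<nu>)
    \<longleftrightarrow> (\<forall>(n, P, \<nu>) \<in> set (nodelist M). good_proc P) \<and> (\<forall>n \<nu>. (n, \<nu>) \<in># shape M \<longrightarrow> n \<notin> \<nu>)"
    unfolding good_proc_def in_shape_iff Ball_def split_paired_All case_prod_conv by blast
  show ?thesis unfolding wf_net_def ok_net_def d e s n by blast
qed

text \<open>Moves leave the topology alone, so along a run only the processes have to be examined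
  again.\<close>

lemma wf_net_shape:
  assumes "wf_net M" "shape M' = shape M" "\<forall>(n, P, \<nu>) \<in> set (nodelist M'). good_proc P"
  shows "wf_net M'"
proof -
  have eqs: "nds M' = nds M" "ok_net M' = ok_net M" using assms(2) by (simp_all only: shape_nds ok_net_def)
  show ?thesis using assms(1,3) unfolding wf_net_alt eqs assms(2) by (elim conjE) (intro conjI)
qed

lemma good_proc_signature: "(\<forall>(n, P, \<nu>) \<in> set (nodelist M). good_proc P) \<longleftrightarrow> (\<forall>(n, h, g, \<nu>) \<in># signature M. g)"
  by (auto simp: signature_def)

lemma scong_wf_net:
  assumes "scong M N" "wf_net M" shows "wf_net N"
proof (rule wf_net_shape[OF assms(2)])
  show "shape N = shape M" using assms(1) by (simp only: scong_shape)
  have "\<forall>(n, P, \<nu>) \<in> set (nodelist M). good_proc P"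
    using assms(2) unfolding wf_net_alt by (rule conjunct1)
  then show "\<forall>(n, P, \<nu>) \<in> set (nodelist N). good_proc P"
    unfolding good_proc_signature scong_signature[OF assms(1)] .
qed

lemma ok_net_shape: "shape M = shape N \<Longrightarrow> ok_net M = ok_net N"
  by (simp only: ok_net_def)

lemma shape_Par: "shape (Par M N) = shape M + shape N"
  by (simp add: shape_def)

lemma ok_net_subset:
  assumes "ok_net L" "shape M \<subseteq># shape L" shows "ok_net M"
  unfolding ok_net_def
proof (intro conjI allI impI)
  note L = assms(1)[unfolded ok_net_def]
  note sub = mset_subset_eqD[OF assms(2)]
  show "n \<notin> \<nu>" if "(n, \<nu>) \<in># shape M" for n \<nu>
    using L sub[OF that] by (elim conjE) blast
  show "count (image_mset fst (shape M)) k \<le> 1" for k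
    using conjunct1[OF conjunct2[OF L], THEN spec, of k]
      mset_subset_eq_count[OF image_mset_subseteq_mono[OF assms(2), of fst], of k] by (rule order.trans[rotated])
  show "m \<in> \<mu> \<longleftrightarrow> n \<in> \<nu>" if "(m, \<nu>) \<in># shape M" "(n, \<mu>) \<in># shape M" for m \<nu> n \<mu>
    using L sub[OF that(1)] sub[OF that(2)] by (elim conjE) blast
qed

lemma ok_net_ParD: "ok_net (Par M N) \<Longrightarrow> ok_net M" "ok_net (Par M N) \<Longrightarrow> ok_net N"
  by (auto simp: shape_Par intro: ok_net_subset[of "Par M N"])

lemma trans_prob: "trans M l \<Delta> \<Longrightarrow> \<forall>(n, P, \<nu>) \<in> set (nodelist M). good_proc P \<Longrightarrow> prob \<Delta>"
  by (induction rule: trans.induct)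
    (auto simp: prob_dirac prob_dpar prob_cdist good_proc_unfold, auto simp: good_proc_def prob_cdist)

section \<open>Structural congruence is a bisimulation\<close>

lemma Par_LSndE:
  assumes "trans (Par M N) (LSnd m v \<mu>) \<Delta>"
  obtains (Left) \<nu> \<Delta>1 \<Delta>2 where "\<mu> = \<nu> - nds N" "\<Delta> = dpar \<Delta>1 \<Delta>2"
      "trans M (LSnd m v \<nu>) \<Delta>1" "trans N (LRcv m v) \<Delta>2"
  | (Right) \<nu> \<Delta>1 \<Delta>2 where "\<mu> = \<nu> - nds M" "\<Delta> = dpar \<Delta>1 \<Delta>2"
      "trans M (LRcv m v) \<Delta>1" "trans N (LSnd m v \<nu>) \<Delta>2"
  using assms by (cases rule: trans.cases) blast+

lemma Par_LRcvE:
  assumes "trans (Par M N) (LRcv m v) \<Delta>"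
  obtains \<Delta>1 \<Delta>2 where "\<Delta> = dpar \<Delta>1 \<Delta>2" "trans M (LRcv m v) \<Delta>1" "trans N (LRcv m v) \<Delta>2"
  using assms by (cases rule: trans.cases) blast+

lemma Par_LSigmaE:
  assumes "trans (Par M N) LSigma \<Delta>"
  obtains \<Delta>1 \<Delta>2 where "\<Delta> = dpar \<Delta>1 \<Delta>2" "trans M LSigma \<Delta>1" "trans N LSigma \<Delta>2"
  using assms by (cases rule: trans.cases) blast+

lemma Par_LTauE:
  assumes "trans (Par M N) LTau \<Delta>"
  obtains (Left) \<Delta>1 where "\<Delta> = dpar \<Delta>1 (dirac N)" "trans M LTau \<Delta>1" "\<not> has_bot N"
  | (Right) \<Delta>1 where "\<Delta> = dpar (dirac M) \<Delta>1" "trans N LTau \<Delta>1" "\<not> has_bot M"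
  | (Snd) m v where "trans (Par M N) (LSnd m v {}) \<Delta>"
  using assms by (cases rule: trans.cases) (auto simp: scong_Par_Bot_iff)

lemma trans_TauL: "trans M LTau \<Delta> \<Longrightarrow> \<not> has_bot N \<Longrightarrow> trans (Par M N) LTau (dpar \<Delta> (dirac N))"
  and trans_TauR: "trans M LTau \<Delta> \<Longrightarrow> \<not> has_bot N \<Longrightarrow> trans (Par N M) LTau (dpar (dirac N) \<Delta>)"
  by (simp_all add: TauParL TauParR scong_Par_Bot_iff)

lemma LObs_iff: "trans M (LObs v \<nu>) \<Delta> \<longleftrightarrow> \<nu> \<noteq> {} \<and> (\<exists>m. trans M (LSnd m v \<nu>) \<Delta>)"
proof
  show "\<nu> \<noteq> {} \<and> (\<exists>m. trans M (LSnd m v \<nu>) \<Delta>)" if "trans M (LObs v \<nu>) \<Delta>"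
    \<comment> \<open>Plain inversion does not suffice: \<open>Rec\<close> may derive the observable
      label from the unfolding.\<close>
    using that by (induction M "LObs v \<nu>" \<Delta> rule: trans.induct) (auto intro: Rec)
qed (auto intro: ObsSnd)

lemma LRcv_unaffected:
  assumes "\<not> has_bot M" "\<forall>(k, P, \<kappa>) \<in> set (nodelist M). k \<noteq> m \<and> \<not> (m \<in> \<kappa> \<and> rcv k \<kappa> P)"
  shows "trans M (LRcv m v) (dirac M)"
  using assms
proof (induction M)
  case (Par M N)
  then show ?case using RcvPar[of M m v "dirac M" N "dirac N"] by (auto simp: dpar_dirac)
next
  case (Node n P \<nu>)
  then show ?case using RcvEnb[of m \<nu> n P v] by auto
qed (auto intro: Rcv0)

text \<open>Each broadcast rule removes the names of the component it passes; at the sender itself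
  nothing is lost, since no node is its own neighbour.\<close>

lemma LSnd_sender:
  assumes "trans M (LSnd m v \<mu>) \<Delta>" "ok_net M"
  shows "\<exists>\<nu>. (m, \<nu>) \<in># shape M \<and> \<mu> = \<nu> - nds M"
  using assms
proof (induction M "LSnd m v \<mu>" \<Delta> arbitrary: \<mu> rule: trans.induct)
  case Snd
  then show ?case by (auto simp: shape_def nds_def ok_net_def)
next
  case (BcastL M \<nu> \<Delta> N \<Theta>)
  then show ?case by (auto simp: shape_Par shape_nds image_Un dest!: ok_net_ParD(1))
next
  case (BcastR M \<nu> \<Delta> N \<Theta>)
  then show ?case by (auto simp: shape_Par shape_nds image_Un dest!: ok_net_ParD(2))
next
  case (Rec n X P \<nu> \<Delta>)
  then show ?case by (auto simp: shape_def nds_def ok_net_def)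
qed

text \<open>All labels are matched, including \<open>LSnd\<close>, which is not an observable
  action: without it the relation would not be closed under the broadcast rules.\<close>

definition sim :: "'v net \<Rightarrow> 'v net \<Rightarrow> bool" where
  "sim M N \<longleftrightarrow> (\<forall>l \<Delta>. trans M l \<Delta> \<longrightarrow> (\<exists>\<Theta>. trans N l \<Theta> \<and> dist_eq \<Delta> \<Theta>))"

text \<open>Observable sends and silenced sends are derived from \<open>LSnd\<close>, so only the
  silent steps with another origin remain; hence the disjunction in the last premise.\<close>

lemma simI:
  assumes snd: "\<And>m v \<nu> \<Delta>. trans M (LSnd m v \<nu>) \<Delta> \<Longrightarrow> \<exists>\<Theta>. trans N (LSnd m v \<nu>) \<Theta> \<and> dist_eq \<Delta> \<Theta>"
    and rcv: "\<And>m v \<Delta>. trans M (LRcv m v) \<Delta> \<Longrightarrow> \<exists>\<Theta>. trans N (LRcv m v) \<Theta> \<and> dist_eq \<Delta> \<Theta>"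
    and signature: "\<And>\<Delta>. trans M LSigma \<Delta> \<Longrightarrow> \<exists>\<Theta>. trans N LSigma \<Theta> \<and> dist_eq \<Delta> \<Theta>"
    and tau: "\<And>\<Delta>. trans M LTau \<Delta> \<Longrightarrow>
      (\<exists>m v. trans M (LSnd m v {}) \<Delta>) \<or> (\<exists>\<Theta>. trans N LTau \<Theta> \<and> dist_eq \<Delta> \<Theta>)"
  shows "sim M N"
  unfolding sim_def
proof (intro allI impI)
  fix l \<Delta> assume "trans M l \<Delta>"
  then show "\<exists>\<Theta>. trans N l \<Theta> \<and> dist_eq \<Delta> \<Theta>"
    by (cases l) (use snd rcv signature tau in \<open>force simp: LObs_iff intro: ShhSnd\<close>)+
qed

lemma sim_refl: "sim M M"
  and sim_trans: "sim M N \<Longrightarrow> sim N L \<Longrightarrow> sim M L"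
  unfolding sim_def by (blast intro: dist_eq_refl, blast intro: dist_eq_trans)

text \<open>Moves of \<open>N\<close> depend on \<open>M\<close> as well: broadcasts lose the names
  of \<open>M\<close>, and silent steps require \<open>M\<close> to be free of \<open>Bot\<close>.
  Congruence preserves both pieces of information.\<close>

lemma sim_ParL:
  assumes M: "scong M M'" "sim M M'"
  shows "sim (Par M N) (Par M' N)"
proof (rule simI)
  have nds: "nds M' = nds M" and bot: "has_bot M' = has_bot M"
    using M(1) scong_nds scong_has_bot by blast+
  have simM: "\<exists>\<Theta>. trans M' l \<Theta> \<and> dist_eq \<Delta> \<Theta>" if "trans M l \<Delta>" for l \<Delta>
    using that M(2) by (simp add: sim_def)
  show "\<exists>\<Theta>. trans (Par M' N) (LSnd m v \<nu>) \<Theta> \<and> dist_eq \<Delta> \<Theta>"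
    if "trans (Par M N) (LSnd m v \<nu>) \<Delta>" for m v \<nu> \<Delta>
    using that
  proof (cases rule: Par_LSndE)
    case Left
    then show ?thesis using simM BcastL dist_eq_dparL by meson
  next
    case (Right \<mu> \<Delta>1 \<Delta>2)
    then obtain \<Theta> where "trans M' (LRcv m v) \<Theta>" "dist_eq \<Delta>1 \<Theta>" using simM by blast
    with Right show ?thesis using BcastR[of N m v \<mu> \<Delta>2 M' \<Theta>] dist_eq_dparL nds by auto
  qed
  show "\<exists>\<Theta>. trans (Par M' N) (LRcv m v) \<Theta> \<and> dist_eq \<Delta> \<Theta>"
    if "trans (Par M N) (LRcv m v) \<Delta>" for m v \<Delta>
    using that by (elim Par_LRcvE) (meson simM RcvPar dist_eq_dparL)
  show "\<exists>\<Theta>. trans (Par M' N) LSigma \<Theta> \<and> dist_eq \<Delta> \<Theta>"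
    if "trans (Par M N) LSigma \<Delta>" for \<Delta>
    using that by (elim Par_LSigmaE) (meson simM SigPar dist_eq_dparL)
  show "(\<exists>m v. trans (Par M N) (LSnd m v {}) \<Delta>) \<or> (\<exists>\<Theta>. trans (Par M' N) LTau \<Theta> \<and> dist_eq \<Delta> \<Theta>)"
    if "trans (Par M N) LTau \<Delta>" for \<Delta>
    using that
  proof (cases rule: Par_LTauE)
    case (Left \<Delta>1)
    then show ?thesis using simM trans_TauL dist_eq_dparL by meson
  next
    case (Right \<Delta>1)
    then have "trans (Par M' N) LTau (dpar (dirac M') \<Delta>1)" using bot trans_TauR by blast
    then show ?thesis using Right(1) M(1) dist_eq_dirac dist_eq_dparL by blast
  qed blast
qed

lemma sim_comm: "sim (Par M N) (Par N M)"
proof (rule simI)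
  show "\<exists>\<Theta>. trans (Par N M) (LSnd m v \<nu>) \<Theta> \<and> dist_eq \<Delta> \<Theta>"
    if "trans (Par M N) (LSnd m v \<nu>) \<Delta>" for m v \<nu> \<Delta>
    using that by (cases rule: Par_LSndE) (use BcastL BcastR dist_eq_dpar_comm in metis)+
  show "\<exists>\<Theta>. trans (Par N M) (LRcv m v) \<Theta> \<and> dist_eq \<Delta> \<Theta>"
    if "trans (Par M N) (LRcv m v) \<Delta>" for m v \<Delta>
    using that by (elim Par_LRcvE) (use RcvPar dist_eq_dpar_comm in metis)
  show "\<exists>\<Theta>. trans (Par N M) LSigma \<Theta> \<and> dist_eq \<Delta> \<Theta>"
    if "trans (Par M N) LSigma \<Delta>" for \<Delta>
    using that by (elim Par_LSigmaE) (use SigPar dist_eq_dpar_comm in metis)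
  show "(\<exists>m v. trans (Par M N) (LSnd m v {}) \<Delta>) \<or> (\<exists>\<Theta>. trans (Par N M) LTau \<Theta> \<and> dist_eq \<Delta> \<Theta>)"
    if "trans (Par M N) LTau \<Delta>" for \<Delta>
    using that by (cases rule: Par_LTauE) (use trans_TauL trans_TauR dist_eq_dpar_comm in metis)+
qed

lemma sim_ParR:
  assumes "scong N N'" "sim N N'"
  shows "sim (Par M N) (Par M N')"
  by (meson assms sim_comm sim_ParL sim_trans)

lemma ok_net_Par_disjoint:
  assumes "ok_net (Par M N)" "k \<in> nds M" shows "k \<notin> nds N"
proof
  assume "k \<in> nds N"
  with assms(2) have "k \<in># image_mset fst (shape M)" "k \<in># image_mset fst (shape N)"
    by (auto simp: shape_nds)
  then have "0 < count (image_mset fst (shape M)) k" "0 < count (image_mset fst (shape N)) k"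
    by (simp_all only: count_greater_zero_iff)
  moreover have "count (image_mset fst (shape M)) k + count (image_mset fst (shape N)) k \<le> 1"
    using assms(1) unfolding ok_net_def shape_Par image_mset_union count_union by (elim conjE) blast
  ultimately show False by linarith
qed

text \<open>This is where well-formedness enters: if the broadcast of a node of \<open>M\<close> has no addressee
  outside \<open>M\<close>, then symmetry of the neighbourhoods lets every node of \<open>N\<close> ignore it.\<close>
lemma LSnd_empty_unaffected:
  assumes "trans M (LSnd m v {}) \<Delta>" "ok_net (Par M N)" "\<not> has_bot N"
  shows "trans N (LRcv m v) (dirac N)"
proof (rule LRcv_unaffected[OF assms(3)])
  obtain \<nu> where \<nu>: "(m, \<nu>) \<in># shape M" "\<nu> \<subseteq> nds M"
    using LSnd_sender[OF assms(1) ok_net_ParD(1)[OF assms(2)]] by auto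
  have disj: "k \<notin> nds M" if "(k, \<kappa>) \<in># shape N" for k \<kappa>
    using ok_net_Par_disjoint[OF assms(2), of k] that by (force simp: shape_nds)
  show "\<forall>(k, P, \<kappa>) \<in> set (nodelist N). k \<noteq> m \<and> \<not> (m \<in> \<kappa> \<and> rcv k \<kappa> P)"
  proof clarify
    fix k P \<kappa> assume "(k, P, \<kappa>) \<in> set (nodelist N)"
    then have k: "(k, \<kappa>) \<in># shape N" by (auto simp: in_shape_iff)
    have "m \<in> nds M" using \<nu>(1) by (force simp: shape_nds)
    have "m \<in> \<kappa> \<longleftrightarrow> k \<in> \<nu>"
      using assms(2) \<nu>(1) k unfolding ok_net_def shape_Par by (elim conjE) (simp only: union_iff, blast)
    then show "k \<noteq> m \<and> \<not> (m \<in> \<kappa> \<and> rcv k \<kappa> P)" using \<nu>(2) disj[OF k] \<open>m \<in> nds M\<close> by auto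
  qed
qed

lemma nds_Par [simp]: "nds (Par M N) = nds M \<union> nds N"
  by (auto simp: nds_def)

lemma sim_assoc:
  assumes "ok_net (Par (Par M N) L)"
  shows "sim (Par (Par M N) L) (Par M (Par N L))"
proof (rule simI)
  have snd: "\<exists>\<Theta>. trans (Par M (Par N L)) (LSnd m v \<nu>) \<Theta> \<and> dist_eq \<Delta> \<Theta>"
    if "trans (Par (Par M N) L) (LSnd m v \<nu>) \<Delta>" for m v \<nu> \<Delta>
    using that
  proof (cases rule: Par_LSndE)
    case (Left \<mu> \<Delta>1 \<Delta>2)
    from Left(3) show ?thesis
    proof (cases rule: Par_LSndE)
      case L: (Left \<mu>' \<Delta>3 \<Delta>4)
      have "\<nu> = \<mu>' - nds (Par N L)" using L Left by auto
      then show ?thesis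
        using L Left BcastL[OF L(3) RcvPar[OF L(4) Left(4)]] dist_eq_dpar_assoc
        by (auto intro!: exI[of _ "dpar \<Delta>3 (dpar \<Delta>4 \<Delta>2)"])
    next
      case R: (Right \<mu>' \<Delta>3 \<Delta>4)
      have "\<nu> = \<mu>' - nds L - nds M" using R Left by auto
      then show ?thesis
        using R Left BcastR[OF BcastL[OF R(4) Left(4)] R(3)] dist_eq_dpar_assoc
        by (auto intro!: exI[of _ "dpar \<Delta>3 (dpar \<Delta>4 \<Delta>2)"])
    qed
  next
    case (Right \<mu> \<Delta>1 \<Delta>2)
    from Right(3) obtain \<Delta>3 \<Delta>4 where R: "\<Delta>1 = dpar \<Delta>3 \<Delta>4" "trans M (LRcv m v) \<Delta>3" "trans N (LRcv m v) \<Delta>4"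
      by (rule Par_LRcvE)
    have "\<nu> = \<mu> - nds N - nds M" using Right by auto
    then show ?thesis
      using R Right BcastR[OF BcastR[OF Right(4) R(3)] R(2)] dist_eq_dpar_assoc
      by (auto intro!: exI[of _ "dpar \<Delta>3 (dpar \<Delta>4 \<Delta>2)"])
  qed
  then show "\<exists>\<Theta>. trans (Par M (Par N L)) (LSnd m v \<nu>) \<Theta> \<and> dist_eq \<Delta> \<Theta>"
    if "trans (Par (Par M N) L) (LSnd m v \<nu>) \<Delta>" for m v \<nu> \<Delta>
    using that .
  show "\<exists>\<Theta>. trans (Par M (Par N L)) (LRcv m v) \<Theta> \<and> dist_eq \<Delta> \<Theta>"
    if "trans (Par (Par M N) L) (LRcv m v) \<Delta>" for m v \<Delta>
    using that by (elim Par_LRcvE) (use dist_eq_dpar_assoc RcvPar in metis)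
  show "\<exists>\<Theta>. trans (Par M (Par N L)) LSigma \<Theta> \<and> dist_eq \<Delta> \<Theta>"
    if "trans (Par (Par M N) L) LSigma \<Delta>" for \<Delta>
    using that by (elim Par_LSigmaE) (use dist_eq_dpar_assoc SigPar in metis)
  show "(\<exists>m v. trans (Par (Par M N) L) (LSnd m v {}) \<Delta>) \<or> (\<exists>\<Theta>. trans (Par M (Par N L)) LTau \<Theta> \<and> dist_eq \<Delta> \<Theta>)"
    if "trans (Par (Par M N) L) LTau \<Delta>" for \<Delta>
    using that
  proof (cases rule: Par_LTauE)
    case (Left \<Delta>1)
    from Left(2) show ?thesis
    proof (cases rule: Par_LTauE)
      case L: (Left \<Delta>2)
      then have "trans (Par M (Par N L)) LTau (dpar \<Delta>2 (dirac (Par N L)))"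
        using Left(3) by (intro trans_TauL) auto
      then show ?thesis using L Left dist_eq_dpar_assoc by (metis dpar_dirac)
    next
      case R: (Right \<Delta>2)
      then have "trans (Par M (Par N L)) LTau (dpar (dirac M) (dpar \<Delta>2 (dirac L)))"
        using Left(3) by (intro trans_TauL trans_TauR) auto
      then show ?thesis using R Left dist_eq_dpar_assoc by metis
    next
      case (Snd m v)
      \<comment> \<open>The broadcast was silenced inside \<open>Par M N\<close>. As
        \<open>L\<close> lets it pass, it is a broadcast of the whole network without addressees,
        which is the first disjunct.\<close>
      have "trans L (LRcv m v) (dirac L)" by (rule LSnd_empty_unaffected[OF Snd assms Left(3)])
      from BcastL[OF Snd this] have "trans (Par (Par M N) L) (LSnd m v {}) \<Delta>" using Left by simp
      then show ?thesis by blast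
    qed
  next
    case (Right \<Delta>1)
    then have "trans (Par M (Par N L)) LTau (dpar (dirac M) (dpar (dirac N) \<Delta>1))"
      by (intro trans_TauR) auto
    then show ?thesis using Right dist_eq_dpar_assoc by (metis dpar_dirac)
  qed blast
qed

lemma Zero_trans:
  "trans Zero l \<Delta> \<longleftrightarrow> \<Delta> = dirac Zero \<and> (l = LSigma \<or> (\<exists>m v. l = LRcv m v))"
proof
  show "\<Delta> = dirac Zero \<and> (l = LSigma \<or> (\<exists>m v. l = LRcv m v))" if "trans Zero l \<Delta>"
    using that by (induction "Zero :: 'a net" l \<Delta> rule: trans.induct) auto
qed (auto intro: Sig0 Rcv0)

lemma sim_unit: "sim (Par M Zero) M"
proof (rule simI)
  show "\<exists>\<Theta>. trans M (LSnd m v \<nu>) \<Theta> \<and> dist_eq \<Delta> \<Theta>"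
    if "trans (Par M Zero) (LSnd m v \<nu>) \<Delta>" for m v \<nu> \<Delta>
    using that by (cases rule: Par_LSndE) (auto simp: Zero_trans nds_def intro: dist_eq_dpar_unit)
  show "\<exists>\<Theta>. trans M (LRcv m v) \<Theta> \<and> dist_eq \<Delta> \<Theta>"
    if "trans (Par M Zero) (LRcv m v) \<Delta>" for m v \<Delta>
    using that by (elim Par_LRcvE) (auto simp: Zero_trans intro: dist_eq_dpar_unit)
  show "\<exists>\<Theta>. trans M LSigma \<Theta> \<and> dist_eq \<Delta> \<Theta>"
    if "trans (Par M Zero) LSigma \<Delta>" for \<Delta>
    using that by (elim Par_LSigmaE) (auto simp: Zero_trans intro: dist_eq_dpar_unit)
  show "(\<exists>m v. trans (Par M Zero) (LSnd m v {}) \<Delta>) \<or> (\<exists>\<Theta>. trans M LTau \<Theta> \<and> dist_eq \<Delta> \<Theta>)"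
    if "trans (Par M Zero) LTau \<Delta>" for \<Delta>
    using that by (cases rule: Par_LTauE) (auto simp: Zero_trans intro: dist_eq_dpar_unit)
qed

lemma sim_unit_rev: "sim M (Par M Zero)"
proof (rule simI)
  note eq = dist_eq_sym[OF dist_eq_dpar_unit]
  show "\<exists>\<Theta>. trans (Par M Zero) (LSnd m v \<nu>) \<Theta> \<and> dist_eq \<Delta> \<Theta>"
    if "trans M (LSnd m v \<nu>) \<Delta>" for m v \<nu> \<Delta>
    using BcastL[OF that Rcv0] eq by (auto simp: nds_def)
  show "\<exists>\<Theta>. trans (Par M Zero) (LRcv m v) \<Theta> \<and> dist_eq \<Delta> \<Theta>"
    if "trans M (LRcv m v) \<Delta>" for m v \<Delta>
    using RcvPar[OF that Rcv0] eq by auto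
  show "\<exists>\<Theta>. trans (Par M Zero) LSigma \<Theta> \<and> dist_eq \<Delta> \<Theta>"
    if "trans M LSigma \<Delta>" for \<Delta>
    using SigPar[OF that Sig0] eq by auto
  show "(\<exists>m v. trans M (LSnd m v {}) \<Delta>) \<or> (\<exists>\<Theta>. trans (Par M Zero) LTau \<Theta> \<and> dist_eq \<Delta> \<Theta>)"
    if "trans M LTau \<Delta>" for \<Delta>
    using trans_TauL[OF that, of Zero] eq by auto
qed

text \<open>\<open>RcvEnb\<close> applies to the folded node directly and leaves it folded, so the
  resulting distributions are only congruent, not equal.\<close>

lemma sim_unfold: "sim (Node n (PFix X P) \<nu>) (Node n (psubst (PFix X P) X P) \<nu>)"
proof (rule simI)
  let ?M = "Node n (PFix X P) \<nu>" and ?N = "Node n (psubst (PFix X P) X P) \<nu>"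
  have rcv_iff: "rcv n \<nu> (psubst (PFix X P) X P) \<longleftrightarrow> rcv n \<nu> (PFix X P)"
    unfolding rcv_def by (meson sc_fix sc_sym sc_trans)
  have *: "trans ?N l \<Delta> \<or> (\<exists>m v. trans ?M (LSnd m v {}) \<Delta> \<and> l = LTau)
      \<or> (\<exists>m v \<nu>. l = LObs v \<nu>) \<or> (\<exists>m v. l = LRcv m v \<and> trans ?N l (dirac ?N) \<and> \<Delta> = dirac ?M)"
    if "trans ?M l \<Delta>" for l \<Delta>
    using that by (cases rule: trans.cases) (auto simp: rcv_iff intro: RcvEnb)
  show "\<exists>\<Theta>. trans ?N (LSnd m v \<nu>') \<Theta> \<and> dist_eq \<Delta> \<Theta>" if "trans ?M (LSnd m v \<nu>') \<Delta>" for m v \<nu>' \<Delta>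
    using *[OF that] by (auto intro: dist_eq_refl)
  show "\<exists>\<Theta>. trans ?N (LRcv m v) \<Theta> \<and> dist_eq \<Delta> \<Theta>" if "trans ?M (LRcv m v) \<Delta>" for m v \<Delta>
    using *[OF that] by (auto intro: dist_eq_refl dist_eq_dirac sc_fix)
  show "\<exists>\<Theta>. trans ?N LSigma \<Theta> \<and> dist_eq \<Delta> \<Theta>" if "trans ?M LSigma \<Delta>" for \<Delta>
    using *[OF that] by (auto intro: dist_eq_refl)
  show "(\<exists>m v. trans ?M (LSnd m v {}) \<Delta>) \<or> (\<exists>\<Theta>. trans ?N LTau \<Theta> \<and> dist_eq \<Delta> \<Theta>)" if "trans ?M LTau \<Delta>" for \<Delta>
    using *[OF that] by (auto intro: dist_eq_refl)
qed

lemma sim_fold: "sim (Node n (psubst (PFix X P) X P) \<nu>) (Node n (PFix X P) \<nu>)"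
  unfolding sim_def by (blast intro: Rec dist_eq_refl)

lemma ok_net_assoc: "ok_net (Par (Par M N) L) \<longleftrightarrow> ok_net (Par M (Par N L))"
  by (rule ok_net_shape) (simp add: shape_Par add.assoc)

text \<open>Rotating the three components by commutativity reduces this to the other direction and
  spares a second case analysis.\<close>

lemma sim_assoc_rev:
  assumes "ok_net (Par M (Par N L))"
  shows "sim (Par M (Par N L)) (Par (Par M N) L)"
proof -
  have sh: "ok_net (Par (Par N L) M)" "ok_net (Par (Par L M) N)"
    using assms by (auto elim!: ok_net_shape[THEN iffD1, rotated] simp: shape_Par)
  have "sim (Par M (Par N L)) (Par (Par N L) M)" by (rule sim_comm)
  moreover have "sim (Par (Par N L) M) (Par N (Par L M))" by (rule sim_assoc[OF sh(1)])
  moreover have "sim (Par N (Par L M)) (Par (Par L M) N)" by (rule sim_comm)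
  moreover have "sim (Par (Par L M) N) (Par L (Par M N))" by (rule sim_assoc[OF sh(2)])
  moreover have "sim (Par L (Par M N)) (Par (Par M N) L)" by (rule sim_comm)
  ultimately show ?thesis by (meson sim_trans)
qed

text \<open>The assumption is \<open>ok_net\<close> and not \<open>wf_net\<close> because the
  induction descends into components of \<open>Par\<close>, which may be disconnected.\<close>

lemma scong_bisim: "scong M N \<Longrightarrow> ok_net M \<Longrightarrow> sim M N \<and> sim N M"
proof (induction rule: scong.induct)
  case (sc_sym M N)
  then show ?case using ok_net_shape[OF scong_shape] by blast
next
  case (sc_trans M N L)
  then show ?case using ok_net_shape[OF scong_shape[OF sc_trans(1)]] sim_trans by blast
next
  case (sc_parL M M' N)
  then show ?case using ok_net_ParD(1) sim_ParL scong.sc_sym by blast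
next
  case (sc_parR N N' M)
  then show ?case using ok_net_ParD(2) sim_ParR scong.sc_sym by blast
next
  case (sc_assoc M N L)
  then show ?case using sim_assoc sim_assoc_rev ok_net_assoc by blast
qed (auto intro: sim_refl sim_comm sim_unit sim_unit_rev sim_unfold sim_fold)

section \<open>Kantorovich bound\<close>

text \<open>On every congruence class \<open>\<Phi>\<close> has \<open>w\<close> times the mass of
  \<open>\<Delta>\<close>, and \<open>\<Psi>\<close> is the remainder. Coupling
  \<open>\<Phi>\<close> within classes is free, and coupling the remainder costs at most its mass
  \<open>1 - w\<close>.\<close>

lemma kant_le:
  assumes \<Delta>: "prob \<Delta>"
    and \<Phi>: "finite (supp \<Phi>)" "\<And>y. 0 \<le> \<Phi> y"
    and \<Psi>: "finite (supp \<Psi>)" "\<And>y. 0 \<le> \<Psi> y" "mass \<Psi> = 1 - w"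
    and eq: "\<And>f. (\<forall>x y. scong x y \<longrightarrow> f x = f y) \<Longrightarrow> expect \<Phi> f = w * expect \<Delta> f"
    and d: "\<And>x y. 0 \<le> d x y" "\<And>x y. d x y \<le> 1" "\<And>x y. scong x y \<Longrightarrow> d x y = 0"
  shows "kant d \<Delta> (\<lambda>y. \<Phi> y + \<Psi> y) \<le> 1 - w"
proof -
  define ind where "ind x y = (if scong x y then 1 else 0 :: real)" for x y :: "'a net"
  define cls where "cls x = expect \<Delta> (ind x)" for x
  \<comment> \<open>Within its class, \<open>x\<close> is spread proportionally to
    \<open>\<Phi>\<close>. The class has \<open>\<Phi>\<close>-mass \<open>w * cls x\<close>, so
    dividing by \<open>cls x\<close> makes this part of the row sum to
    \<open>w * \<Delta> x\<close>. The remainder is coupled independently.\<close>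
  define \<omega> where "\<omega> = (\<lambda>(x, y). ind x y * \<Delta> x * \<Phi> y / cls x + \<Delta> x * \<Psi> y)"
  define A where "A = supp \<Delta>"
  define B where "B = supp \<Phi> \<union> supp \<Psi>"
  have \<Delta>': "finite A" "\<And>x. 0 \<le> \<Delta> x" "(\<Sum>x\<in>A. \<Delta> x) = 1"
    using \<Delta> by (auto simp: prob_def A_def mass_def)
  have finB: "finite B" using \<Phi> \<Psi> by (simp add: B_def)
  have ind_eq: "ind x z = ind y z" "ind z x = ind z y" if "scong x y" for x y z
    using that unfolding ind_def by (auto intro: sc_sym sc_trans)
  have ev\<Delta>: "expect \<Delta> f = (\<Sum>x\<in>A. \<Delta> x * f x)" for f by (simp add: expect_def A_def)
  have ev\<Phi>: "expect \<Phi> f = (\<Sum>x\<in>B. \<Phi> x * f x)" for f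
    using finB by (intro expect_superset) (auto simp: B_def)
  have sum\<Psi>: "(\<Sum>y\<in>B. \<Psi> y) = 1 - w"
    using expect_superset[of B \<Psi> "\<lambda>_. 1"] finB \<Psi>(3) by (simp add: expect_one B_def)
  have ind_nn: "0 \<le> ind x y" for x y by (simp add: ind_def)
  have cls_nn: "0 \<le> cls x" for x
    unfolding cls_def expect_def using \<Delta>'(2) ind_nn by (intro sum_nonneg) auto
  have cls_eq: "cls x = cls y" if "scong x y" for x y
    unfolding cls_def using ind_eq(1)[OF that] by (metis ext)
  have cls_pos: "0 < cls x" if "x \<in> A" for x
  proof -
    have "\<Delta> x * ind x x \<le> cls x"
      unfolding cls_def ev\<Delta> using that \<Delta>' ind_nn by (intro member_le_sum) auto
    moreover have "0 < \<Delta> x" using that \<Delta>'(2)[of x] by (auto simp: A_def supp_def)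
    ultimately show ?thesis by (simp add: ind_def sc_refl)
  qed
  have expect_ind: "expect \<Phi> (ind x) = w * cls x" for x
    unfolding cls_def using ind_eq(2) by (intro eq) blast
  have \<omega>_nn: "0 \<le> \<omega> z" for z
    unfolding \<omega>_def using \<Delta>'(2) \<Phi>(2) \<Psi>(2) ind_nn cls_nn by (auto intro!: add_nonneg_nonneg divide_nonneg_nonneg split: prod.splits)
  have supp\<omega>: "supp \<omega> \<subseteq> A \<times> B"
    by (auto simp: supp_def A_def B_def \<omega>_def)
  have fin\<omega>: "finite (supp \<omega>)" using supp\<omega> \<Delta>'(1) finB finite_subset by blast
  have sum\<omega>: "(\<Sum>z\<in>supp \<omega>. g z) = (\<Sum>x\<in>A. \<Sum>y\<in>B. g (x, y))" if "\<And>z. \<omega> z = 0 \<Longrightarrow> g z = 0" for g :: "_ \<Rightarrow> real"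
  proof -
    have "(\<Sum>z\<in>supp \<omega>. g z) = (\<Sum>z\<in>A \<times> B. g z)"
      using supp\<omega> \<Delta>'(1) finB that by (intro sum.mono_neutral_left) (auto simp: supp_def)
    then show ?thesis by (simp add: sum.cartesian_product)
  qed
  have row: "(\<Sum>y\<in>B. \<omega> (x, y)) = \<Delta> x" if "x \<in> A" for x
  proof -
    have "(\<Sum>y\<in>B. \<omega> (x, y)) = \<Delta> x / cls x * (\<Sum>y\<in>B. \<Phi> y * ind x y) + \<Delta> x * (\<Sum>y\<in>B. \<Psi> y)"
      by (simp add: \<omega>_def sum.distrib sum_distrib_left mult.commute mult.left_commute)
    also have "\<dots> = \<Delta> x / cls x * (w * cls x) + \<Delta> x * (1 - w)"
      by (simp only: ev\<Phi>[symmetric] expect_ind sum\<Psi>)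
    also have "\<dots> = \<Delta> x" using cls_pos[OF that] by (simp add: algebra_simps)
    finally show ?thesis .
  qed
  have col: "(\<Sum>x\<in>A. \<omega> (x, y)) = \<Phi> y + \<Psi> y" for y
  proof -
    have "ind x y * \<Delta> x * \<Phi> y / cls x = \<Phi> y / cls y * (\<Delta> x * ind y x)" for x
      using cls_eq[of x y] by (auto simp: ind_def dest: sc_sym)
    then have "(\<Sum>x\<in>A. \<omega> (x, y)) = \<Phi> y / cls y * (\<Sum>x\<in>A. \<Delta> x * ind y x) + \<Psi> y * (\<Sum>x\<in>A. \<Delta> x)"
      by (simp add: \<omega>_def sum.distrib sum_distrib_left mult.commute)
    then have "(\<Sum>x\<in>A. \<omega> (x, y)) = \<Phi> y / cls y * cls y + \<Psi> y * (\<Sum>x\<in>A. \<Delta> x)"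
      by (simp add: cls_def ev\<Delta>)
    \<comment> \<open>Division by zero yields 0, so the column sum is right only if
      \<open>\<Phi>\<close> vanishes on classes that \<open>\<Delta>\<close> does not
      charge.\<close>
    moreover have "\<Phi> y = 0" if "cls y = 0"
    proof (rule ccontr)
      assume "\<Phi> y \<noteq> 0"
      then have "\<Phi> y * ind y y \<le> expect \<Phi> (ind y)"
        unfolding expect_def using \<Phi> ind_nn by (intro member_le_sum) (auto simp: supp_def)
      then show False using expect_ind[of y] that \<open>\<Phi> y \<noteq> 0\<close> \<Phi>(2)[of y] by (simp add: ind_def sc_refl)
    qed
    ultimately show ?thesis using \<Delta>'(3) by (cases "cls y = 0") auto
  qed
  have "matching \<omega> \<Delta> (\<lambda>y. \<Phi> y + \<Psi> y)"
    unfolding matching_def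
  proof (intro conjI allI)
    fix M
    have "(\<Sum>z\<in>supp \<omega>. if fst z = M then \<omega> z else 0) = (\<Sum>x\<in>A. if x = M then \<Sum>y\<in>B. \<omega> (x, y) else 0)"
      by (subst sum\<omega>) (auto intro!: sum.cong)
    also have "\<dots> = \<Delta> M" using \<Delta>'(1) row by (simp add: A_def supp_def)
    finally show "\<Delta> M = (\<Sum>z\<in>supp \<omega>. if fst z = M then \<omega> z else 0)" by simp
  next
    fix M
    have "(\<Sum>z\<in>supp \<omega>. if snd z = M then \<omega> z else 0) = (\<Sum>y\<in>B. \<Sum>x\<in>A. if y = M then \<omega> (x, y) else 0)"
      by (subst sum\<omega>) (auto intro: sum.swap)
    also have "\<dots> = (\<Sum>y\<in>B. if y = M then \<Phi> y + \<Psi> y else 0)"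
      by (intro sum.cong) (auto simp: col)
    also have "\<dots> = \<Phi> M + \<Psi> M" using finB by (simp add: B_def supp_def)
    finally show "\<Phi> M + \<Psi> M = (\<Sum>z\<in>supp \<omega>. if snd z = M then \<omega> z else 0)" by simp
  qed (use fin\<omega> \<omega>_nn in auto)
  then have "kant d \<Delta> (\<lambda>y. \<Phi> y + \<Psi> y) \<le> (\<Sum>z\<in>supp \<omega>. \<omega> z * d (fst z) (snd z))"
    unfolding kant_def
    by (intro cInf_lower bdd_belowI[of _ 0]) (auto simp: matching_def intro!: sum_nonneg mult_nonneg_nonneg d)
  also have "\<dots> = (\<Sum>x\<in>A. \<Sum>y\<in>B. \<omega> (x, y) * d x y)"
    by (subst sum\<omega>) auto
  also have "\<dots> \<le> (\<Sum>x\<in>A. \<Sum>y\<in>B. \<Delta> x * \<Psi> y)"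
  proof (intro sum_mono)
    fix x y
    have "\<Delta> x * \<Psi> y * d x y \<le> \<Delta> x * \<Psi> y * 1"
      using \<Delta>'(2) \<Psi>(2) d(2) by (intro mult_left_mono) auto
    then show "\<omega> (x, y) * d x y \<le> \<Delta> x * \<Psi> y"
      using d(3)[of x y] \<Delta>'(2) \<Psi>(2) by (auto simp: \<omega>_def ind_def)
  qed
  also have "\<dots> = 1 - w"
    by (simp add: sum_distrib_left[symmetric] sum_distrib_right[symmetric] \<Delta>' sum\<Psi>)
  finally show ?thesis .
qed

section \<open>Mixtures and weak transitions\<close>

definition mix :: "'b set \<Rightarrow> ('b \<Rightarrow> real) \<Rightarrow> ('b \<Rightarrow> 'a \<Rightarrow> real) \<Rightarrow> 'a \<Rightarrow> real" where
  "mix K c T = (\<lambda>y. \<Sum>x\<in>K. c x * T x y)"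

lemma finite_supp_mix:
  assumes "finite K" "\<And>x. x \<in> K \<Longrightarrow> finite (supp (T x))"
  shows "finite (supp (mix K c T))"
proof (rule finite_subset)
  show "supp (mix K c T) \<subseteq> (\<Union>x\<in>K. supp (T x))"
  proof
    fix y assume "y \<in> supp (mix K c T)"
    then have "(\<Sum>x\<in>K. c x * T x y) \<noteq> 0" by (simp add: supp_def mix_def)
    then obtain x where "x \<in> K" "c x * T x y \<noteq> 0" by (meson sum.neutral)
    then show "y \<in> (\<Union>x\<in>K. supp (T x))" by (auto simp: supp_def)
  qed
qed (use assms in auto)

lemma expect_mix:
  assumes "finite K" "\<And>x. x \<in> K \<Longrightarrow> finite (supp (T x))"
  shows "expect (mix K c T) f = (\<Sum>x\<in>K. c x * expect (T x) f)"
proof -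
  define A where "A = supp (mix K c T) \<union> (\<Union>x\<in>K. supp (T x))"
  have A: "finite A" unfolding A_def using assms finite_supp_mix[OF assms, where c = c] by auto
  have "expect (mix K c T) f = (\<Sum>y\<in>A. mix K c T y * f y)"
    using A by (intro expect_superset) (auto simp: A_def)
  also have "\<dots> = (\<Sum>x\<in>K. c x * (\<Sum>y\<in>A. T x y * f y))"
    unfolding mix_def sum_distrib_left sum_distrib_right by (subst sum.swap) (simp add: mult.assoc)
  also have "\<dots> = (\<Sum>x\<in>K. c x * expect (T x) f)"
    using A by (intro sum.cong refl arg_cong[where f = "(*) _"] expect_superset[symmetric]) (auto simp: A_def)
  finally show ?thesis .
qed

lemma mix_nonneg:
  assumes "\<And>x. x \<in> K \<Longrightarrow> 0 \<le> c x" "\<And>x. x \<in> K \<Longrightarrow> 0 \<le> T x y"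
  shows "0 \<le> mix K c T y"
  unfolding mix_def using assms by (intro sum_nonneg) auto

lemma mass_mix:
  assumes "finite K" "\<And>x. x \<in> K \<Longrightarrow> prob (T x)"
  shows "mass (mix K c T) = (\<Sum>x\<in>K. c x)"
  using assms expect_mix[of K T c "\<lambda>_. 1"] by (simp add: expect_one prob_def)

text \<open>Passes from weight functions to the list form of the definition: each support point is
  listed once, and \<open>K\<close> turns into the set of positions that move.\<close>

lemma lift_hatI:
  assumes \<Delta>: "finite (supp \<Delta>)" "\<And>x. 0 \<le> \<Delta> x"
    and K: "K \<subseteq> supp \<Delta>" "K \<noteq> {}" "\<And>x. x \<in> K \<Longrightarrow> hat_trans x a (T x)"
    and stuck: "\<And>x \<Theta>. x \<in> supp \<Delta> - K \<Longrightarrow> \<not> hat_trans x a \<Theta>"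
  shows "lift_hat \<Delta> a (mix K \<Delta> T)"
proof -
  obtain zs where zs: "set zs = supp \<Delta>" "distinct zs"
    using finite_distinct_list[OF \<Delta>(1)] by blast
  define J where "J = {i. i < length zs \<and> zs ! i \<in> K}"
  have bij: "bij_betw ((!) zs) J K"
    unfolding bij_betw_def
  proof
    show "inj_on ((!) zs) J" using zs(2) by (auto simp: inj_on_def J_def nth_eq_iff_index_eq)
    show "(!) zs ` J = K"
      using K(1) zs(1) by (auto simp: J_def image_iff) (metis in_set_conv_nth subsetD)
  qed
  let ?xs = "map (\<lambda>x. (\<Delta> x, x)) zs"
  have h1: "\<Delta> = (\<lambda>N. \<Sum>(p, M)\<leftarrow>?xs. if N = M then p else 0)"
    using zs \<Delta>(1) by (auto simp: fun_eq_iff comp_def sum_list_distinct_conv_sum_set supp_def)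
  have h2: "\<forall>(p, M) \<in> set ?xs. 0 < p"
    using zs(1) \<Delta>(2) by (auto simp: supp_def less_le)
  have h3: "J \<subseteq> {..<length ?xs}" by (auto simp: J_def)
  have h4: "J \<noteq> {}" using bij K(2) by (auto simp: bij_betw_def)
  have h5: "\<forall>j\<in>J. hat_trans (snd (?xs ! j)) a (T (zs ! j))"
    by (simp add: J_def K(3))
  have h6: "\<forall>i\<in>{..<length ?xs} - J. \<not> (\<exists>\<Theta>'. hat_trans (snd (?xs ! i)) a \<Theta>')"
  proof
    fix i assume "i \<in> {..<length ?xs} - J"
    then have i: "i < length zs" "zs ! i \<notin> K" by (simp_all add: J_def)
    then have "zs ! i \<in> supp \<Delta> - K" using nth_mem[OF i(1)] zs(1) by blast
    with i(1) show "\<not> (\<exists>\<Theta>'. hat_trans (snd (?xs ! i)) a \<Theta>')" using stuck by auto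
  qed
  have h7: "mix K \<Delta> T = (\<lambda>N. \<Sum>j\<in>J. fst (?xs ! j) * T (zs ! j) N)"
  proof
    fix N
    have "mix K \<Delta> T N = (\<Sum>j\<in>J. \<Delta> (zs ! j) * T (zs ! j) N)"
      unfolding mix_def by (rule sum.reindex_bij_betw[OF bij, symmetric])
    also have "\<dots> = (\<Sum>j\<in>J. fst (?xs ! j) * T (zs ! j) N)"
      by (intro sum.cong) (auto simp: J_def)
    finally show "mix K \<Delta> T N = \<dots>" .
  qed
  show ?thesis
    unfolding lift_hat_def
    by (rule exI[of _ ?xs], intro conjI exI[of _ J] exI[of _ "\<lambda>j. T (zs ! j)"]) (fact h1 h2 h3 h4 h5 h6 h7)+
qed

lemma lift_hat_dirac: "hat_trans M a \<Delta> \<Longrightarrow> lift_hat (dirac M) a \<Delta>"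
  using lift_hatI[of "dirac M" "{M}" a "\<lambda>_. \<Delta>"] by (simp add: supp_dirac mix_def) (simp add: dirac_def)

lemma hat_tau_self: "hat_trans M LTau (dirac M)"
  by (simp add: hat_trans_def)

text \<open>Every network may idle under the weak silent label, so no component is ever dropped. The
  lifting then treats list entries separately, and lists can be concatenated.\<close>

lemma lift_hat_tau_iff:
  "lift_hat \<Delta> LTau \<Theta> \<longleftrightarrow> (\<exists>ys. ys \<noteq> [] \<and> (\<forall>(p, M, T) \<in> set ys. 0 < p \<and> hat_trans M LTau T)
    \<and> \<Delta> = (\<lambda>N. \<Sum>(p, M, T)\<leftarrow>ys. if N = M then p else 0)
    \<and> \<Theta> = (\<lambda>N. \<Sum>(p, M, T)\<leftarrow>ys. p * T N))" (is "_ \<longleftrightarrow> (\<exists>ys. ?P ys)")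
proof
  assume "lift_hat \<Delta> LTau \<Theta>"
  then obtain xs J \<Theta>s where xs: "\<forall>(p, M) \<in> set xs. 0 < p"
      "\<Delta> = (\<lambda>N. \<Sum>(p, M)\<leftarrow>xs. if N = M then p else 0)"
    and J: "J \<subseteq> {..<length xs}" "J \<noteq> {}" "\<forall>j\<in>J. hat_trans (snd (xs ! j)) LTau (\<Theta>s j)"
      "\<forall>i\<in>{..<length xs} - J. \<not> (\<exists>\<Theta>'. hat_trans (snd (xs ! i)) LTau \<Theta>')"
      "\<Theta> = (\<lambda>N. \<Sum>j\<in>J. fst (xs ! j) * \<Theta>s j N)"
    unfolding lift_hat_def by blast
  have J_eq: "J = {..<length xs}" using J(1,4) hat_tau_self by blast
  define ys where "ys = map (\<lambda>i. (fst (xs ! i), snd (xs ! i), \<Theta>s i)) [0..<length xs]"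
  have "ys \<noteq> []" using J(2) J_eq by (auto simp: ys_def)
  moreover have "\<forall>(p, M, T) \<in> set ys. 0 < p \<and> hat_trans M LTau T"
    using xs(1) J(3) J_eq by (auto simp: ys_def) (metis nth_mem prod.collapse case_prodD)
  moreover have "\<Delta> = (\<lambda>N. \<Sum>(p, M, T)\<leftarrow>ys. if N = M then p else 0)"
    unfolding xs(2) ys_def by (auto simp: sum_list_sum_nth case_prod_unfold intro!: sum.cong)
  moreover have "\<Theta> = (\<lambda>N. \<Sum>(p, M, T)\<leftarrow>ys. p * T N)"
    unfolding J(5) J_eq ys_def by (auto simp: sum_list_sum_nth lessThan_atLeast0 intro!: sum.cong)
  ultimately show "\<exists>ys. ?P ys" by blast
next
  assume "\<exists>ys. ?P ys"
  then obtain ys where ys: "ys \<noteq> []" "\<forall>(p, M, T) \<in> set ys. 0 < p \<and> hat_trans M LTau T"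
    "\<Delta> = (\<lambda>N. \<Sum>(p, M, T)\<leftarrow>ys. if N = M then p else 0)" "\<Theta> = (\<lambda>N. \<Sum>(p, M, T)\<leftarrow>ys. p * T N)"
    by blast
  have hat: "hat_trans (fst (snd (ys ! i))) LTau (snd (snd (ys ! i)))" if "i < length ys" for i
    using ys(2) nth_mem[OF that] by (auto simp: case_prod_unfold)
  show "lift_hat \<Delta> LTau \<Theta>"
    unfolding lift_hat_def
  proof (rule exI[of _ "map (\<lambda>(p, M, T). (p, M)) ys"],
      intro conjI exI[of _ "{..<length ys}"] exI[of _ "\<lambda>j. snd (snd (ys ! j))"])
    let ?xs = "map (\<lambda>(p, M, T). (p, M)) ys"
    show "\<forall>(p, M) \<in> set ?xs. 0 < p" using ys(2) by auto
    show "\<Delta> = (\<lambda>N. \<Sum>(p, M)\<leftarrow>?xs. if N = M then p else 0)"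
      unfolding ys(3) by (simp add: comp_def case_prod_unfold cong: if_cong)
    show "{..<length ys} \<subseteq> {..<length ?xs}" "{..<length ys} \<noteq> {}" using ys(1) by auto
    show "\<forall>j\<in>{..<length ys}. hat_trans (snd (?xs ! j)) LTau (snd (snd (ys ! j)))"
      using hat by (simp add: case_prod_unfold)
    show "\<forall>i\<in>{..<length ?xs} - {..<length ys}. \<not> (\<exists>\<Theta>'. hat_trans (snd (?xs ! i)) LTau \<Theta>')" by simp
    show "\<Theta> = (\<lambda>N. \<Sum>j\<in>{..<length ys}. fst (?xs ! j) * snd (snd (ys ! j)) N)"
      unfolding ys(4) by (auto simp: sum_list_sum_nth lessThan_atLeast0 case_prod_unfold intro!: sum.cong)
  qed
qed

text \<open>The part \<open>R\<close> idles while the scaled part makes its step.\<close>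

lemma lift_hat_extend:
  assumes "lift_hat \<Delta> LTau \<Theta>" "0 < c" "finite (supp R)" "\<And>x. 0 \<le> R x"
  shows "lift_hat (\<lambda>y. c * \<Delta> y + R y) LTau (\<lambda>y. c * \<Theta> y + R y)"
proof -
  obtain ys where ys: "ys \<noteq> []" "\<forall>(p, M, T) \<in> set ys. 0 < p \<and> hat_trans M LTau T"
    "\<Delta> = (\<lambda>N. \<Sum>(p, M, T)\<leftarrow>ys. if N = M then p else 0)" "\<Theta> = (\<lambda>N. \<Sum>(p, M, T)\<leftarrow>ys. p * T N)"
    using assms(1) unfolding lift_hat_tau_iff by blast
  obtain rs where rs: "set rs = supp R" "distinct rs"
    using finite_distinct_list[OF assms(3)] by blast
  define zs where "zs = map (\<lambda>(p, M, T). (c * p, M, T)) ys @ map (\<lambda>x. (R x, x, dirac x)) rs"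
  have R: "R N = (\<Sum>x\<leftarrow>rs. if N = x then R x else 0)" for N
    using rs assms(3) by (auto simp: sum_list_distinct_conv_sum_set supp_def)
  have R': "R N = (\<Sum>x\<leftarrow>rs. R x * dirac x N)" for N
    unfolding dirac_def by (subst R) (auto intro!: arg_cong[where f = sum_list])
  have "zs \<noteq> []" using ys(1) by (simp add: zs_def)
  moreover have "\<forall>(p, M, T) \<in> set zs. 0 < p \<and> hat_trans M LTau T"
    using ys(2) rs(1) assms(2,4) hat_tau_self by (auto simp: zs_def supp_def less_le)
  moreover {
    have "c * (\<Sum>(p, M, T)\<leftarrow>ys. if N = M then p else 0)
        = (\<Sum>(p, M, T)\<leftarrow>map (\<lambda>(p, M, T). (c * p, M, T)) ys. if N = M then p else 0)"
      for N and ys :: "(real \<times> 'a net \<times> 'a dist) list"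
      by (induction ys) (auto simp: algebra_simps)
    then have "(\<lambda>y. c * \<Delta> y + R y) = (\<lambda>N. \<Sum>(p, M, T)\<leftarrow>zs. if N = M then p else 0)"
      unfolding ys(3) zs_def by (simp add: comp_def R[symmetric] cong: if_cong)
  }
  moreover have "(\<lambda>y. c * \<Theta> y + R y) = (\<lambda>N. \<Sum>(p, M, T)\<leftarrow>zs. p * T N)"
    unfolding ys(4) zs_def
    by (auto simp: fun_eq_iff comp_def case_prod_unfold sum_list_const_mult[symmetric] R'[symmetric] mult.assoc)
  ultimately show ?thesis unfolding lift_hat_tau_iff by blast
qed

lemma weak_tau_extend:
  assumes "weak_tau \<Delta> \<Theta>" "0 < c" "finite (supp R)" "\<And>x. 0 \<le> R x"
  shows "weak_tau (\<lambda>y. c * \<Delta> y + R y) (\<lambda>y. c * \<Theta> y + R y)"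
  using assms(1) unfolding weak_tau_def
proof (induction rule: rtranclp_induct)
  case (step \<Theta> \<Psi>)
  then show ?case using lift_hat_extend[OF step(2) assms(2-4)] by (meson rtranclp.rtrancl_into_rtrancl)
qed simp

lemma weak_tau_trans: "weak_tau \<Delta> \<Theta> \<Longrightarrow> weak_tau \<Theta> \<Psi> \<Longrightarrow> weak_tau \<Delta> \<Psi>"
  unfolding weak_tau_def by (rule rtranclp_trans)

lemma weak_tau_refl: "weak_tau \<Delta> \<Delta>"
  unfolding weak_tau_def by simp

text \<open>The support points may need silent runs of different lengths, so they run to completion
  one after the other while the remaining mass idles.\<close>

lemma weak_tau_bind:
  assumes \<Delta>: "prob \<Delta>" and T: "\<And>x. x \<in> supp \<Delta> \<Longrightarrow> weak_tau (dirac x) (T x) \<and> prob (T x)"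
  shows "weak_tau \<Delta> (mix (supp \<Delta>) \<Delta> T)"
proof -
  have fin: "finite (supp \<Delta>)" using \<Delta> by (simp add: prob_def)
  \<comment> \<open>Invariant: the points of \<open>F\<close> have been replaced by their targets,
    and all others still carry their original mass.\<close>
  have "weak_tau \<Delta> (\<lambda>y. mix F \<Delta> T y + (if y \<in> F then 0 else \<Delta> y))" if "finite F" "F \<subseteq> supp \<Delta>" for F
    using that
  proof (induction F)
    case empty
    then show ?case by (simp add: mix_def weak_tau_refl)
  next
    case (insert x F)
    define R where "R y = mix F \<Delta> T y + (if y \<in> insert x F then 0 else \<Delta> y)" for y
    have "finite (supp R)"
    proof (rule finite_subset)
      show "supp R \<subseteq> supp (mix F \<Delta> T) \<union> supp \<Delta>" by (auto simp: R_def supp_def)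
      show "finite (supp (mix F \<Delta> T) \<union> supp \<Delta>)"
        using fin insert T by (auto intro!: finite_supp_mix simp: prob_def)
    qed
    moreover have "0 \<le> R y" for y
      using \<Delta> T insert.prems by (auto simp: R_def prob_def intro!: add_nonneg_nonneg mix_nonneg)
    moreover have "0 < \<Delta> x" using insert.prems \<Delta> by (auto simp: supp_def prob_def less_le)
    ultimately have "weak_tau (\<lambda>y. \<Delta> x * dirac x y + R y) (\<lambda>y. \<Delta> x * T x y + R y)"
      using T insert.prems by (intro weak_tau_extend) auto
    moreover have "(\<lambda>y. \<Delta> x * dirac x y + R y) = (\<lambda>y. mix F \<Delta> T y + (if y \<in> F then 0 else \<Delta> y))"
      using insert.hyps by (auto simp: R_def dirac_def fun_eq_iff)
    moreover have "(\<lambda>y. \<Delta> x * T x y + R y)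
        = (\<lambda>y. mix (insert x F) \<Delta> T y + (if y \<in> insert x F then 0 else \<Delta> y))"
      by (rule ext) (simp add: R_def mix_def insert.hyps add.assoc)
    moreover have "weak_tau \<Delta> (\<lambda>y. mix F \<Delta> T y + (if y \<in> F then 0 else \<Delta> y))"
      using insert.IH insert.prems by simp
    ultimately show ?case by (simp only: weak_tau_trans)
  qed
  from this[of "supp \<Delta>"] fin
  have "weak_tau \<Delta> (\<lambda>y. mix (supp \<Delta>) \<Delta> T y + (if y \<in> supp \<Delta> then 0 else \<Delta> y))" by simp
  moreover have "(\<lambda>y. mix (supp \<Delta>) \<Delta> T y + (if y \<in> supp \<Delta> then 0 else \<Delta> y)) = mix (supp \<Delta>) \<Delta> T"
    by (auto simp: fun_eq_iff supp_def)
  ultimately show ?thesis by simp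
qed

lemma expect_add_Bot:
  assumes "finite (supp \<Delta>)"
  shows "expect (\<lambda>y. \<Delta> y + (if y = b then c else 0)) f = expect \<Delta> f + c * f b"
proof -
  have "expect (\<lambda>y. \<Delta> y + (if y = b then c else 0)) f
      = (\<Sum>y\<in>insert b (supp \<Delta>). \<Delta> y * f y + (if y = b then c * f y else 0))"
    by (subst expect_superset[of "insert b (supp \<Delta>)"]) (use assms in \<open>auto simp: supp_def algebra_simps intro!: sum.cong\<close>)
  also have "\<dots> = (\<Sum>y\<in>insert b (supp \<Delta>). \<Delta> y * f y) + c * f b"
    using assms by (simp add: sum.distrib)
  also have "(\<Sum>y\<in>insert b (supp \<Delta>). \<Delta> y * f y) = expect \<Delta> f"
    using assms by (intro expect_superset[symmetric]) auto
  finally show ?thesis .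
qed

lemma hat_trans_prob: "hat_trans M a \<Delta> \<Longrightarrow> wf_net M \<Longrightarrow> prob \<Delta>"
  unfolding hat_trans_def wf_net_alt by (auto split: if_splits intro: trans_prob prob_dirac)

text \<open>The part of \<open>\<Theta>\<close> congruent to \<open>A\<close> is matched at cost 0; the rest, including what is
  lost to \<open>Bot\<close>, is charged the maximal distance 1.\<close>
lemma weak_match:
  assumes A: "wf_net A" "trans A a \<Delta>"
    and \<Theta>: "weak_tau (dirac B) \<Theta>" "prob \<Theta>" "\<And>y. y \<in> supp \<Theta> \<Longrightarrow> wf_net y"
    and w: "w = expect \<Theta> (\<lambda>y. if scong A y then 1 else 0)" "0 < w"
    and d: "\<And>x y. 0 \<le> d x y" "\<And>x y. d x y \<le> 1" "\<And>x y. scong x y \<Longrightarrow> d x y = 0"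
  shows "\<exists>\<Psi>. weak_trans B a \<Psi> \<and> kant d \<Delta> (pad_bot \<Psi>) \<le> 1 - w"
proof -
  have fin: "finite (supp \<Theta>)" and \<Theta>_nn: "0 \<le> \<Theta> y" for y using \<Theta>(2) by (auto simp: prob_def)
  have okA: "ok_net A" using A(1) by (simp add: wf_net_alt)
  \<comment> \<open>One choice of successors serves two purposes: bisimilarity supplies the answer
    for \<open>y\<close> congruent to \<open>A\<close>, and any move will do elsewhere. Moves
    elsewhere cannot be suppressed, since the lifting drops only components that cannot
    move.\<close>
  have "\<forall>y. \<exists>t. (scong A y \<longrightarrow> trans y a t \<and> dist_eq \<Delta> t) \<and> ((\<exists>t'. hat_trans y a t') \<longrightarrow> hat_trans y a t)"
  proof
    fix y
    show "\<exists>t. (scong A y \<longrightarrow> trans y a t \<and> dist_eq \<Delta> t) \<and> ((\<exists>t'. hat_trans y a t') \<longrightarrow> hat_trans y a t)"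
    proof (cases "scong A y")
      case True
      have "sim A y" using scong_bisim[OF True okA] by simp
      then obtain t where "trans y a t" "dist_eq \<Delta> t" using A(2) unfolding sim_def by blast
      then show ?thesis by (intro exI[of _ t]) (auto simp: hat_trans_def)
    qed blast
  qed
  then obtain T where T: "\<And>y. scong A y \<Longrightarrow> trans y a (T y) \<and> dist_eq \<Delta> (T y)"
      "\<And>y t'. hat_trans y a t' \<Longrightarrow> hat_trans y a (T y)"
    by metis
  define K where "K = {y \<in> supp \<Theta>. \<exists>t. hat_trans y a t}"
  define G where "G = {y \<in> supp \<Theta>. scong A y}"
  define \<Psi> where "\<Psi> = mix K \<Theta> T"
  have K: "K \<subseteq> supp \<Theta>" "finite K" using fin by (auto simp: K_def)
  have GK: "G \<subseteq> K" using T(1) by (auto simp: G_def K_def hat_trans_def)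
  then have "finite G" using K(2) finite_subset by blast
  have probT: "prob (T y)" if "y \<in> K" for y
  proof -
    have "hat_trans y a (T y)" "y \<in> supp \<Theta>" using that T(2) by (auto simp: K_def)
    then show ?thesis using hat_trans_prob \<Theta>(3) by blast
  qed
  have wG: "w = (\<Sum>y\<in>G. \<Theta> y)"
    unfolding w(1) expect_def G_def using fin by (auto simp: sum.If_cases if_distrib Int_def cong: if_cong)
  \<comment> \<open>Here \<open>0 < w\<close> matters: a lifted step requires at least one moving
    component.\<close>
  then have "K \<noteq> {}" using w(2) GK by auto
  have lift: "lift_hat \<Theta> a \<Psi>"
    unfolding \<Psi>_def
  proof (rule lift_hatI[OF fin \<Theta>_nn K(1) \<open>K \<noteq> {}\<close>])
    show "hat_trans x a (T x)" if "x \<in> K" for x using that T(2) by (auto simp: K_def)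
    show "\<not> hat_trans x a t" if "x \<in> supp \<Theta> - K" for x t using that by (auto simp: K_def)
  qed
  have "weak_trans B a \<Psi>"
  proof (cases "a = LTau")
    case True
    then have "weak_tau \<Theta> \<Psi>" using lift by (simp add: weak_tau_def r_into_rtranclp)
    then show ?thesis using True \<Theta>(1) weak_tau_trans by (simp add: weak_trans_def) blast
  next
    case False
    then show ?thesis using \<Theta>(1) lift weak_tau_refl by (auto simp: weak_trans_def)
  qed
  moreover have "kant d \<Delta> (pad_bot \<Psi>) \<le> 1 - w"
  proof -
    \<comment> \<open>The remainder collects the moves made outside the class of \<open>A\<close>
      and the mass that could not move, which \<open>pad_bot\<close> puts on
      \<open>Bot\<close>.\<close>
    define R where "R y = mix (K - G) \<Theta> T y + (if y = Bot then 1 - mass \<Psi> else 0)" for y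
    have split: "\<Psi> y = mix G \<Theta> T y + mix (K - G) \<Theta> T y" for y
      unfolding \<Psi>_def mix_def by (subst sum.subset_diff[OF GK K(2)]) simp
    have mass\<Psi>: "mass \<Psi> = (\<Sum>y\<in>K. \<Theta> y)"
      unfolding \<Psi>_def by (rule mass_mix) (use K probT in auto)
    have "(\<Sum>y\<in>K. \<Theta> y) \<le> (\<Sum>y\<in>supp \<Theta>. \<Theta> y)"
      using fin K \<Theta>_nn by (intro sum_mono2) auto
    moreover have "(\<Sum>y\<in>supp \<Theta>. \<Theta> y) = 1" using \<Theta>(2) by (simp add: prob_def mass_def)
    ultimately have mass_le: "mass \<Psi> \<le> 1" unfolding mass\<Psi> by simp
    have finR: "finite (supp (mix (K - G) \<Theta> T))"
      using K probT by (intro finite_supp_mix) (auto simp: prob_def)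
    have "mass R = mass (mix (K - G) \<Theta> T) + (1 - mass \<Psi>)"
      using expect_add_Bot[OF finR, where b = Bot and c = "1 - mass \<Psi>" and f = "\<lambda>_. 1"] by (simp add: expect_one R_def[abs_def])
    also have "mass (mix (K - G) \<Theta> T) = (\<Sum>y\<in>K - G. \<Theta> y)"
      by (rule mass_mix) (use K probT in auto)
    also have "\<dots> + (1 - mass \<Psi>) = 1 - w"
      unfolding mass\<Psi> wG using sum.subset_diff[OF GK K(2), of \<Theta>] by simp
    finally have massR: "mass R = 1 - w" .
    have "kant d \<Delta> (\<lambda>y. mix G \<Theta> T y + R y) \<le> 1 - w"
    proof (rule kant_le[OF _ _ _ _ _ massR _ d])
      show "prob \<Delta>" using A by (auto simp: wf_net_alt intro: trans_prob)
      show "finite (supp (mix G \<Theta> T))"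
        using \<open>finite G\<close> probT GK by (intro finite_supp_mix) (auto simp: prob_def)
      show "0 \<le> mix G \<Theta> T y" for y
        using \<Theta>_nn probT GK by (intro mix_nonneg) (auto simp: prob_def)
      show "finite (supp R)"
        by (rule finite_subset[of _ "insert Bot (supp (mix (K - G) \<Theta> T))"])
          (use finR in \<open>auto simp: R_def supp_def\<close>)
      show "0 \<le> R y" for y
        unfolding R_def using \<Theta>_nn probT mass_le by (intro add_nonneg_nonneg mix_nonneg) (auto simp: prob_def)
      show "expect (mix G \<Theta> T) f = w * expect \<Delta> f" if f: "\<forall>x y. scong x y \<longrightarrow> f x = f y" for f
      proof -
        have "expect (mix G \<Theta> T) f = (\<Sum>y\<in>G. \<Theta> y * expect (T y) f)"
          using \<open>finite G\<close> probT GK by (intro expect_mix) (auto simp: prob_def)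
        also have "\<dots> = (\<Sum>y\<in>G. \<Theta> y * expect \<Delta> f)"
          using T(1) f by (intro sum.cong) (auto simp: G_def dist_eq_def)
        finally show ?thesis by (simp add: wG sum_distrib_right)
      qed
    qed
    moreover have "pad_bot \<Psi> = (\<lambda>y. mix G \<Theta> T y + R y)"
      by (auto simp: pad_bot_def R_def split fun_eq_iff)
    ultimately show ?thesis by simp
  qed
  ultimately show ?thesis by blast
qed

text \<open>\<open>s\<close> bounds the probability of missing the class of \<open>L\<close>.
  Well-formedness on the support ensures that the moves taken from there are full probability
  distributions.\<close>

definition reaches :: "'v net \<Rightarrow> 'v net \<Rightarrow> real \<Rightarrow> bool" where
  "reaches L M s \<longleftrightarrow> (\<exists>\<Theta>. weak_tau (dirac M) \<Theta> \<and> prob \<Theta> \<and> (\<forall>y\<in>supp \<Theta>. wf_net y)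
    \<and> 1 - s \<le> expect \<Theta> (\<lambda>y. if scong L y then 1 else 0))"

lemma reaches_self: "scong L M \<Longrightarrow> wf_net M \<Longrightarrow> reaches L M 0"
  unfolding reaches_def by (intro exI[of _ "dirac M"]) (simp add: weak_tau_refl prob_dirac supp_dirac)

lemma reaches_trivial: "wf_net M \<Longrightarrow> reaches L M 1"
  unfolding reaches_def by (intro exI[of _ "dirac M"]) (simp add: weak_tau_refl prob_dirac supp_dirac)

text \<open>Total probability: the bounds of the successors may differ, and they average to a bound
  for the source.\<close>

lemma reaches_step:
  assumes "wf_net M" "trans M LTau \<Delta>" "\<And>x. x \<in> supp \<Delta> \<Longrightarrow> reaches L x (s x)"
  shows "reaches L M (expect \<Delta> s)"
proof -
  let ?ind = "\<lambda>y. if scong L y then 1 else 0 :: real"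
  have \<Delta>: "prob \<Delta>" using assms(1,2) by (auto simp: wf_net_alt intro: trans_prob)
  then have fin: "finite (supp \<Delta>)" by (simp add: prob_def)
  obtain T where T: "\<And>x. x \<in> supp \<Delta> \<Longrightarrow> weak_tau (dirac x) (T x) \<and> prob (T x) \<and> (\<forall>y\<in>supp (T x). wf_net y)
    \<and> 1 - s x \<le> expect (T x) ?ind"
    using assms(3) unfolding reaches_def by metis
  have "weak_tau (dirac M) \<Delta>"
    unfolding weak_tau_def using assms(2) by (intro r_into_rtranclp lift_hat_dirac) (simp add: hat_trans_def)
  then have "weak_tau (dirac M) (mix (supp \<Delta>) \<Delta> T)"
    using weak_tau_bind[OF \<Delta>] T weak_tau_trans by blast
  moreover have "prob (mix (supp \<Delta>) \<Delta> T)"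
  proof -
    have "mass (mix (supp \<Delta>) \<Delta> T) = 1"
      using \<Delta> T fin by (subst mass_mix) (auto simp: prob_def mass_def)
    moreover have "finite (supp (mix (supp \<Delta>) \<Delta> T))"
      using T fin by (intro finite_supp_mix) (auto simp: prob_def)
    moreover have "0 \<le> mix (supp \<Delta>) \<Delta> T y" for y
      using \<Delta> T by (intro mix_nonneg) (auto simp: prob_def)
    ultimately show ?thesis by (simp add: prob_def)
  qed
  moreover have "wf_net y" if "y \<in> supp (mix (supp \<Delta>) \<Delta> T)" for y
  proof -
    have "(\<Sum>x\<in>supp \<Delta>. \<Delta> x * T x y) \<noteq> 0" using that by (simp add: supp_def mix_def)
    then obtain x where "x \<in> supp \<Delta>" "\<Delta> x * T x y \<noteq> 0" by (meson sum.neutral)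
    then show ?thesis using T by (auto simp: supp_def)
  qed
  moreover have "1 - expect \<Delta> s \<le> expect (mix (supp \<Delta>) \<Delta> T) ?ind"
  proof -
    have "1 - expect \<Delta> s = (\<Sum>x\<in>supp \<Delta>. \<Delta> x * (1 - s x))"
      using \<Delta> by (simp add: expect_def prob_def mass_def right_diff_distrib sum_subtractf)
    also have "\<dots> \<le> (\<Sum>x\<in>supp \<Delta>. \<Delta> x * expect (T x) ?ind)"
      using \<Delta> T by (intro sum_mono mult_left_mono) (auto simp: prob_def)
    also have "\<dots> = expect (mix (supp \<Delta>) \<Delta> T) ?ind"
      using T fin by (intro expect_mix[symmetric]) (auto simp: prob_def)
    finally show ?thesis .
  qed
  ultimately show ?thesis unfolding reaches_def by blast
qed

text \<open>The indicator of the class of \<open>x\<close> serves as test function.\<close>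

lemma dist_eq_supp:
  assumes "dist_eq \<Delta> \<Theta>" "prob \<Delta>" "x \<in> supp \<Delta>"
  shows "\<exists>y\<in>supp \<Theta>. scong x y"
proof (rule ccontr)
  assume no: "\<not> (\<exists>y\<in>supp \<Theta>. scong x y)"
  let ?f = "\<lambda>y. if scong x y then 1 else 0 :: real"
  have "\<forall>a b. scong a b \<longrightarrow> ?f a = ?f b" by (auto intro: sc_sym sc_trans)
  then have "expect \<Delta> ?f = expect \<Theta> ?f" by (rule assms(1)[unfolded dist_eq_def, THEN spec, THEN mp])
  also have "expect \<Theta> ?f = 0" unfolding expect_def using no by (intro sum.neutral) auto
  finally have "expect \<Delta> ?f = 0" .
  moreover have "\<Delta> x * ?f x \<le> expect \<Delta> ?f"
    unfolding expect_def using assms(2,3) by (intro member_le_sum) (auto simp: prob_def)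
  ultimately show False using assms(2,3) by (auto simp: prob_def supp_def sc_refl order.antisym)
qed

text \<open>The step is computed on a convenient representative \<open>M'\<close> and pulled back
  along bisimilarity. Since \<open>s\<close> is constant on classes, the actual step of
  \<open>M\<close> averages it to the same value.\<close>

lemma reaches_scong_step:
  assumes M: "wf_net M" "scong M M'" "trans M' LTau \<Theta>"
    and s: "\<And>x y. scong x y \<Longrightarrow> s x = s y"
    and reach: "\<And>x y. y \<in> supp \<Theta> \<Longrightarrow> scong x y \<Longrightarrow> reaches L x (s x)"
  shows "reaches L M (expect \<Theta> s)"
proof -
  have "sim M' M" using scong_bisim[OF M(2)] M(1) by (simp add: wf_net_alt)
  then obtain \<Delta> where \<Delta>: "trans M LTau \<Delta>" "dist_eq \<Theta> \<Delta>"
    using M(3) unfolding sim_def by blast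
  have "prob \<Delta>" using \<Delta>(1) M(1) by (auto simp: wf_net_alt intro: trans_prob)
  then have "reaches L x (s x)" if "x \<in> supp \<Delta>" for x
    using dist_eq_supp[OF dist_eq_sym[OF \<Delta>(2)] _ that] reach by blast
  then have "reaches L M (expect \<Delta> s)" by (rule reaches_step[OF M(1) \<Delta>(1)])
  moreover have "expect \<Theta> s = expect \<Delta> s" using \<Delta>(2) s unfolding dist_eq_def by simp
  ultimately show ?thesis by simp
qed

section \<open>Iterated parallel composition\<close>

lemma nodelist_bigpar: "nodelist (bigpar I f) = concat (map (\<lambda>i. nodelist (f i)) (sorted_list_of_set I))"
proof -
  have "nodelist (foldr (\<lambda>i acc. Par (f i) acc) xs Zero) = concat (map (\<lambda>i. nodelist (f i)) xs)" for xs
    by (induction xs) auto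
  then show ?thesis by (simp add: bigpar_def)
qed

lemma set_nodelist_bigpar: "finite I \<Longrightarrow> set (nodelist (bigpar I f)) = (\<Union>i\<in>I. set (nodelist (f i)))"
  by (simp add: nodelist_bigpar)

lemma bigpar_cong:
  assumes "\<And>i. i \<in> I \<Longrightarrow> f i = g i" shows "bigpar I f = bigpar I g"
proof (cases "finite I")
  case True
  then show ?thesis unfolding bigpar_def using assms by (intro foldr_cong) auto
qed (simp add: bigpar_def)

lemma has_bot_bigpar: "(\<And>i. \<not> has_bot (f i)) \<Longrightarrow> \<not> has_bot (bigpar I f)"
proof -
  assume "\<And>i. \<not> has_bot (f i)"
  then have "\<not> has_bot (foldr (\<lambda>i acc. Par (f i) acc) xs Zero)" for xs
    by (induction xs) auto
  then show ?thesis by (simp add: bigpar_def)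
qed

lemma shape_bigpar_cong:
  fixes f g :: "nat \<Rightarrow> 'v net"
  assumes "\<And>i. shape (f i) = shape (g i)"
  shows "shape (bigpar I f) = shape (bigpar I g)"
proof -
  have "shape (foldr (\<lambda>i acc. Par (f i) acc) xs Zero) = shape (foldr (\<lambda>i acc. Par (g i) acc) xs Zero)" for xs
    by (induction xs) (auto simp: shape_Par assms)
  then show ?thesis by (simp add: bigpar_def)
qed

lemma bigpar_remove:
  assumes "finite I" "i \<in> I"
  shows "scong (bigpar I f) (Par (f i) (bigpar (I - {i}) f))"
proof -
  have swap: "scong (Par a (Par b c)) (Par b (Par a c))" for a b c :: "'b net"
    by (meson sc_assoc sc_comm sc_parL sc_sym sc_trans)
  have "scong (foldr (\<lambda>i acc. Par (f i) acc) xs Zero) (Par (f i) (foldr (\<lambda>i acc. Par (f i) acc) (remove1 i xs) Zero))"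
    if "i \<in> set xs" for xs
    using that
  proof (induction xs)
    case (Cons x xs)
    show ?case
    proof (cases "x = i")
      case True
      then show ?thesis by (simp add: sc_refl)
    next
      case False
      with Cons show ?thesis using swap sc_parR sc_trans by fastforce
    qed
  qed simp
  from this[of "sorted_list_of_set I"] show ?thesis
    using assms by (simp add: bigpar_def sorted_list_of_set_remove)
qed

lemma bigpar_LRcv:
  assumes "finite I" "\<And>i. i \<in> I \<Longrightarrow> trans (f i) (LRcv k v) (dirac (g i))"
  shows "trans (bigpar I f) (LRcv k v) (dirac (bigpar I g))"
proof -
  have "trans (foldr (\<lambda>i acc. Par (f i) acc) xs Zero) (LRcv k v) (dirac (foldr (\<lambda>i acc. Par (g i) acc) xs Zero))"
    if "set xs \<subseteq> I" for xs
    using that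
  proof (induction xs)
    case (Cons x xs)
    then have "trans (f x) (LRcv k v) (dirac (g x))" using assms(2) by simp
    from RcvPar[OF this Cons.IH] Cons.prems show ?case by (simp add: dpar_dirac)
  qed (simp add: Rcv0)
  from this[of "sorted_list_of_set I"] assms(1) show ?thesis by (simp add: bigpar_def)
qed

section \<open>Gossip processes\<close>

lemma head_kind_gossip [simp]: "head_kind (gsnd u p) = 3" "head_kind (gresnd u p) = 4"
  by (simp_all add: gsnd_def gresnd_def)

lemma wf_choice_shape_poplus: "0 \<le> p \<Longrightarrow> p \<le> 1 \<Longrightarrow> wf_choice_shape (poplus p P Q)"
  by (auto simp: wf_choice_shape_def poplus_def)

lemma set_poplus: "snd ` set (poplus p P Q) \<subseteq> {P, Q}"
  by (auto simp: poplus_def)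

lemma good_proc_gsnd: "0 \<le> p \<Longrightarrow> p \<le> 1 \<Longrightarrow> good_proc (gsnd (Val v) p)"
  using wf_choice_shape_poplus[of p]
  by (auto simp: good_proc_def closed_proc_def gsnd_def list_all_iff wf_choice_shape_def poplus_def)

lemma good_proc_gresnd: "0 \<le> p \<Longrightarrow> p \<le> 1 \<Longrightarrow> good_proc (gresnd (Val v) p)"
  using good_proc_gsnd[of p v] by (auto simp: good_proc_def closed_proc_def gresnd_def wf_choice_shape_def)

lemma good_proc_gfwd: "0 \<le> p \<Longrightarrow> p \<le> 1 \<Longrightarrow> good_proc (gfwd p)"
  by (auto simp: good_proc_def closed_proc_def gfwd_def gresnd_def gsnd_def wf_choice_shape_def poplus_def)

lemma good_proc_PNil: "good_proc PNil"
  by (simp add: good_proc_def closed_proc_def)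

lemma good_proc_PSnd: "good_proc (PSnd (Val v) [(1, PNil)])"
  by (simp add: good_proc_def closed_proc_def wf_choice_shape_def)

lemma gfwd_LRcv:
  fixes v :: 'v
  assumes "k \<in> \<nu>"
  shows "trans (Node n (gfwd p) \<nu>) (LRcv k v) (dirac (Node n (gresnd (Val v) p) \<nu>))"
proof -
  have v: "vsubst v 0 (gresnd (Var 0) p) = gresnd (Val v) p"
    and p: "psubst (gfwd p) 0 (gresnd (Var 0) p :: 'v proc) = gresnd (Var 0) p"
    by (simp_all add: gresnd_def gsnd_def poplus_def)
  show ?thesis
    unfolding gfwd_def
  proof (rule Rec)
    show "trans (Node n (psubst (PFix 0 (PRcv 0 [(1, gresnd (Var 0) p)] [(1, PVar 0)])) 0
        (PRcv 0 [(1, gresnd (Var 0) p)] [(1, PVar 0)])) \<nu>) (LRcv k v) (dirac (Node n (gresnd (Val v) p) \<nu>))"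
      using Rcv[OF assms, of n 0 "[(1, gresnd (Var 0) p)]" "[(1, gfwd p)]" v] v p
      unfolding gfwd_def[symmetric] by (simp add: cdist_singleton)
  qed
qed

lemma gsnd_LTau: "trans (Node n (gsnd u p) \<nu>) LTau (cdist n (poplus p (PSnd u [(1, PNil)]) PNil) \<nu>)"
  unfolding gsnd_def by (rule Tau)

text \<open>Uniform in \<open>p\<close>, although \<open>poplus\<close> drops a branch at the values
  0 and 1.\<close>

lemma expect_poplus: "expect (cdist n (poplus p P Q) \<nu>) f = p * f (Node n P \<nu>) + (1 - p) * f (Node n Q \<nu>)"
  by (simp add: expect_cdist poplus_def)

section \<open>The gossip network and its stages\<close>

locale gossip =
  fixes I J :: "nat set" and v :: 'v and p q :: "nat \<Rightarrow> real"
    and M N :: "'v net" and m n :: "nat \<Rightarrow> nat" and nu :: "nat \<Rightarrow> nat set"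
  assumes finite: "finite I" "finite J"
    and p: "\<forall>i\<in>I. 0 \<le> p i \<and> p i \<le> 1"
    and q: "\<forall>j\<in>J. 0 \<le> q j \<and> q j \<le> 1"
    and wfM: "wf_net M"
    and M: "scong M (Par N (Par (bigpar I (\<lambda>i. Node (m i) (gsnd (Val v) (p i)) (nu (m i))))
                             (bigpar J (\<lambda>j. Node (n j) (gfwd (q j)) (nu (n j))))))"
    and nbhd: "\<forall>i\<in>I. n ` J \<subseteq> nu (m i) \<and> nu (m i) \<subseteq> nds M"
    and deaf: "\<forall>i\<in>I. \<forall>(k, P, \<mu>) \<in> set (nodelist N). k \<in> nu (m i) \<longrightarrow> \<not> rcv k \<mu> P"
begin

definition sender :: "nat set \<Rightarrow> nat \<Rightarrow> 'v net" where
  "sender S i = Node (m i) (if i \<in> S then gsnd (Val v) (p i) else PNil) (nu (m i))"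

definition receiver :: "bool \<Rightarrow> nat \<Rightarrow> 'v net" where
  "receiver b j = Node (n j) (if b then gresnd (Val v) (q j) else gfwd (q j)) (nu (n j))"

text \<open>The senders in \<open>S\<close> have not yet moved, and \<open>b\<close> tells whether some sender has broadcast.\<close>
definition stage :: "nat set \<Rightarrow> bool \<Rightarrow> 'v net" where
  "stage S b = Par N (Par (bigpar I (sender S)) (bigpar J (receiver b)))"

definition Rest :: "nat set \<Rightarrow> bool \<Rightarrow> nat \<Rightarrow> 'v net" where
  "Rest S b i = Par N (Par (bigpar (I - {i}) (sender S)) (bigpar J (receiver b)))"

lemma stage_initial:
  "stage I False = Par N (Par (bigpar I (\<lambda>i. Node (m i) (gsnd (Val v) (p i)) (nu (m i))))
    (bigpar J (\<lambda>j. Node (n j) (gfwd (q j)) (nu (n j)))))"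
proof -
  have "bigpar I (sender I) = bigpar I (\<lambda>i. Node (m i) (gsnd (Val v) (p i)) (nu (m i)))"
    by (intro bigpar_cong) (simp add: sender_def)
  then show ?thesis by (simp add: stage_def receiver_def[abs_def])
qed

lemma stage_final:
  "stage {} True = Par N (Par (bigpar I (\<lambda>i. Node (m i) PNil (nu (m i))))
    (bigpar J (\<lambda>j. Node (n j) (gresnd (Val v) (q j)) (nu (n j)))))"
  by (simp add: stage_def sender_def[abs_def] receiver_def[abs_def])

lemma stage_front: "i \<in> I \<Longrightarrow> scong (stage S b) (Par (sender S i) (Rest S b i))"
proof -
  assume i: "i \<in> I"
  have swap: "scong (Par a (Par b c)) (Par b (Par a c))" for a b c :: "'v net"
    by (meson sc_assoc sc_comm sc_parL sc_sym sc_trans)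
  let ?F = "bigpar J (receiver b)" and ?R = "bigpar (I - {i}) (sender S)"
  have "scong (Par (bigpar I (sender S)) ?F) (Par (Par (sender S i) ?R) ?F)"
    by (intro sc_parL bigpar_remove finite i)
  then have "scong (Par (bigpar I (sender S)) ?F) (Par (sender S i) (Par ?R ?F))"
    using sc_assoc sc_trans by blast
  then have "scong (stage S b) (Par N (Par (sender S i) (Par ?R ?F)))"
    unfolding stage_def by (rule sc_parR)
  then show ?thesis
    unfolding Rest_def using swap sc_trans by blast
qed

text \<open>The surroundings of sender \<open>i\<close> do not record whether \<open>i\<close>
  itself has moved, so they stay put when \<open>i\<close> leaves \<open>S\<close>.\<close>

lemma Rest_remove: "Rest (S - {i}) b i = Rest S b i"
proof -
  have "bigpar (I - {i}) (sender (S - {i})) = bigpar (I - {i}) (sender S)"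
    by (intro bigpar_cong) (simp add: sender_def)
  then show ?thesis by (simp add: Rest_def)
qed

lemma wf_initial: "wf_net (stage I False)"
  using scong_wf_net[OF M wfM] by (simp add: stage_initial)

lemma shape_stage: "shape (stage S b) = shape (stage I False)"
proof -
  have "shape (bigpar I (sender S)) = shape (bigpar I (sender I))"
    "shape (bigpar J (receiver b)) = shape (bigpar J (receiver False))"
    by (rule shape_bigpar_cong; simp add: sender_def receiver_def shape_def)+
  then show ?thesis by (simp add: stage_def shape_Par)
qed

lemma good_proc_N: "\<forall>(k, P, \<nu>) \<in> set (nodelist N). good_proc P"
  using wf_initial by (auto simp: wf_net_alt stage_def)

lemma good_proc_sender: "i \<in> I \<Longrightarrow> (k, P, \<nu>) \<in> set (nodelist (sender S i)) \<Longrightarrow> good_proc P"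
  using p by (auto simp: sender_def good_proc_PNil good_proc_gsnd)

lemma good_proc_receiver: "j \<in> J \<Longrightarrow> (k, P, \<nu>) \<in> set (nodelist (receiver b j)) \<Longrightarrow> good_proc P"
  using q by (auto simp: receiver_def good_proc_gfwd good_proc_gresnd split: if_splits)

lemma set_nodelist_stage:
  "set (nodelist (stage S b)) = set (nodelist N) \<union> (\<Union>i\<in>I. set (nodelist (sender S i)))
    \<union> (\<Union>j\<in>J. set (nodelist (receiver b j)))"
  by (simp add: stage_def set_nodelist_bigpar finite Un_assoc)

lemma set_nodelist_Rest: "set (nodelist (Rest S b i)) \<subseteq> set (nodelist (stage S b))"
  by (auto simp: stage_def Rest_def set_nodelist_bigpar finite)

lemma good_proc_stage: "(k, P, \<nu>) \<in> set (nodelist (stage S b)) \<Longrightarrow> good_proc P"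
  unfolding set_nodelist_stage using good_proc_N good_proc_sender good_proc_receiver by blast

lemma wf_stage: "wf_net (stage S b)"
  using good_proc_stage by (intro wf_net_shape[OF wf_initial shape_stage]) blast

text \<open>Covers the networks in which sender \<open>i\<close> has resolved its choice but not yet
  transmitted; these are not stages.\<close>

lemma wf_front:
  assumes "i \<in> I" "good_proc P"
  shows "wf_net (Par (Node (m i) P (nu (m i))) (Rest S b i))"
proof (rule wf_net_shape[OF wf_stage])
  have "shape (Par (Node (m i) P (nu (m i))) (Rest S b i)) = shape (Par (sender S i) (Rest S b i))"
    by (simp add: shape_Par) (simp add: sender_def shape_def)
  then show "shape (Par (Node (m i) P (nu (m i))) (Rest S b i)) = shape (stage S b)"
    using scong_shape[OF stage_front[OF assms(1)]] by simp
  have "good_proc Q" if "(k, Q, \<nu>) \<in> set (nodelist (Rest S b i))" for k Q \<nu>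
    using that set_nodelist_Rest good_proc_stage by blast
  then show "\<forall>(k, P, \<nu>) \<in> set (nodelist (Par (Node (m i) P (nu (m i))) (Rest S b i))). good_proc P"
    using assms(2) by auto
qed

lemma in_shape_sender: "i \<in> I \<Longrightarrow> (m i, nu (m i)) \<in># shape (stage S b)"
proof -
  assume i: "i \<in> I"
  obtain P where "(m i, P, nu (m i)) \<in> set (nodelist (sender S i))" by (simp add: sender_def)
  then have "(m i, P, nu (m i)) \<in> set (nodelist (stage S b))"
    using i unfolding set_nodelist_stage by blast
  then show ?thesis by (auto simp: in_shape_iff)
qed

lemma ok_net_stage: "ok_net (stage S b)"
  using wf_stage by (simp add: wf_net_alt)

text \<open>The receive rules inspect the neighbours of the receiver, the assumptions those of the
  sender; symmetry translates between them.\<close>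

lemma sym_stage:
  assumes "i \<in> I" "(k, P, \<kappa>) \<in> set (nodelist (stage S b))"
  shows "m i \<in> \<kappa> \<longleftrightarrow> k \<in> nu (m i)"
proof -
  have "(k, \<kappa>) \<in># shape (stage S b)" using assms(2) by (auto simp: in_shape_iff)
  then show ?thesis using ok_net_stage[of S b] in_shape_sender[OF assms(1), of S b] unfolding ok_net_def by (elim conjE) blast
qed

lemma notin_Rest: "i \<in> I \<Longrightarrow> m i \<notin> nds (Rest S b i)"
  using ok_net_Par_disjoint[of "sender S i" "Rest S b i" "m i"] ok_net_stage[of S b] scong_shape[OF stage_front[of i S b]]
  by (simp add: ok_net_shape[of "stage S b"]) (simp add: sender_def nds_def)

text \<open>All neighbours of a sender lie in \<open>M\<close>, whose names are those of the sender
  and of its surroundings, and the sender is not its own neighbour. This makes its broadcast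
  silent.\<close>

lemma nbhd_Rest: "i \<in> I \<Longrightarrow> nu (m i) - nds (Rest S b i) = {}"
proof -
  assume i: "i \<in> I"
  have "nds M = nds (stage I False)" using scong_nds[OF M] by (simp only: stage_initial)
  also have "\<dots> = nds (Par (sender S i) (Rest S b i))"
    using shape_stage[of S b] scong_shape[OF stage_front[OF i, of S b]] by (simp add: shape_nds del: nds_Par)
  also have "\<dots> = insert (m i) (nds (Rest S b i))" by (simp add: sender_def nds_def)
  finally have "nu (m i) \<subseteq> insert (m i) (nds (Rest S b i))" using nbhd i by blast
  moreover have "m i \<notin> nu (m i)"
    using ok_net_stage[of S b] in_shape_sender[OF i, of S b] unfolding ok_net_def by (elim conjE) blast
  ultimately show ?thesis by blast
qed

text \<open>Nodes of \<open>N\<close> are deaf or out of range, senders never listen, and fresh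
  forwarders hear the message. Forwarders that have received before are in a \<open>PSigma\<close>
  state and ignore it, so the outcome has flag \<open>True\<close> for either value of
  \<open>b\<close>.\<close>

lemma Rest_LRcv:
  assumes i: "i \<in> I" and bot: "\<not> has_bot N"
  shows "trans (Rest S b i) (LRcv (m i) v) (dirac (Rest S True i))"
proof -
  have ne: "k \<noteq> m i" if "(k, P, \<kappa>) \<in> set (nodelist (Rest S b i))" for k P \<kappa>
    using notin_Rest[OF i, of S b] that by (force simp: nds_def)
  have N: "trans N (LRcv (m i) v) (dirac N)"
  proof (rule LRcv_unaffected[OF bot], clarify)
    fix k P \<kappa> assume k: "(k, P, \<kappa>) \<in> set (nodelist N)"
    then have "k \<noteq> m i" using ne[of k P \<kappa>] by (simp add: Rest_def)
    moreover have "m i \<in> \<kappa> \<longleftrightarrow> k \<in> nu (m i)" using k by (intro sym_stage[OF i, where S = S and b = b and P = P]) (simp add: stage_def)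
    moreover have "k \<in> nu (m i) \<longrightarrow> \<not> rcv k \<kappa> P" using bspec[OF bspec[OF deaf i] k] by simp
    ultimately show "k \<noteq> m i \<and> \<not> (m i \<in> \<kappa> \<and> rcv k \<kappa> P)" by blast
  qed
  moreover have "trans (bigpar (I - {i}) (sender S)) (LRcv (m i) v) (dirac (bigpar (I - {i}) (sender S)))"
  proof (rule bigpar_LRcv)
    fix k assume k: "k \<in> I - {i}"
    obtain P where P: "(m k, P, nu (m k)) \<in> set (nodelist (sender S k))" by (simp add: sender_def)
    have "(m k, P, nu (m k)) \<in> set (nodelist (bigpar (I - {i}) (sender S)))"
      unfolding set_nodelist_bigpar[OF finite_Diff[OF finite(1)]] using k P by (rule UN_I)
    then have "m k \<noteq> m i" using ne[of "m k" P "nu (m k)"] by (simp add: Rest_def)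
    then show "trans (sender S k) (LRcv (m i) v) (dirac (sender S k))"
      by (intro LRcv_unaffected) (auto simp: sender_def not_rcv)
  qed (simp add: finite)
  moreover have "trans (bigpar J (receiver b)) (LRcv (m i) v) (dirac (bigpar J (receiver True)))"
  proof (rule bigpar_LRcv)
    fix j assume j: "j \<in> J"
    obtain P where "(n j, P, nu (n j)) \<in> set (nodelist (receiver b j))" by (simp add: receiver_def)
    with j have P: "(n j, P, nu (n j)) \<in> set (nodelist (bigpar J (receiver b)))"
      unfolding set_nodelist_bigpar[OF finite(2)] by (rule UN_I)
    then have "n j \<noteq> m i" using ne[of "n j" P "nu (n j)"] by (simp add: Rest_def)
    moreover have "m i \<in> nu (n j)"
      using sym_stage[OF i, of "n j" P "nu (n j)" S b] P nbhd i j by (auto simp: stage_def)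
    ultimately show "trans (receiver b j) (LRcv (m i) v) (dirac (receiver True j))"
      by (cases b) (auto simp: receiver_def gfwd_LRcv not_rcv intro!: LRcv_unaffected)
  qed (simp add: finite)
  ultimately show ?thesis
    unfolding Rest_def by (auto simp: dpar_dirac[symmetric] intro!: RcvPar)
qed

lemma not_has_bot_Rest: "\<not> has_bot N \<Longrightarrow> \<not> has_bot (Rest S b i)"
  using has_bot_bigpar[of "sender S" "I - {i}"] has_bot_bigpar[of "receiver b" J]
  by (simp add: Rest_def) (simp add: sender_def receiver_def)

text \<open>After the choice to transmit nothing more can be lost: the broadcast is a silent Dirac
  step and sets the flag, so the bound 0 of the next stage carries over.\<close>

lemma reaches_sent:
  assumes bot: "\<not> has_bot N" and i: "i \<in> I"
    and X: "scong X (Par (Node (m i) (PSnd (Val v) [(1, PNil)]) (nu (m i))) (Rest S b i))"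
    and IH: "\<And>Y. scong Y (stage (S - {i}) True) \<Longrightarrow> reaches L Y 0"
  shows "reaches L X 0"
proof -
  let ?X = "Par (Node (m i) (PSnd (Val v) [(1, PNil)]) (nu (m i))) (Rest S b i)"
  let ?Y = "Par (Node (m i) PNil (nu (m i))) (Rest S True i)"
  have "wf_net X" using scong_wf_net[OF sc_sym[OF X] wf_front[OF i good_proc_PSnd]] .
  have "trans (Node (m i) (PSnd (Val v) [(1, PNil)]) (nu (m i))) (LSnd (m i) v (nu (m i)))
      (dirac (Node (m i) PNil (nu (m i))))"
    using Snd[of "m i" v "[(1, PNil)]" "nu (m i)"] by (simp add: cdist_singleton)
  from BcastL[OF this Rest_LRcv[OF i bot, of S b]]
  have "trans ?X (LSnd (m i) v {}) (dirac ?Y)" by (simp add: nbhd_Rest[OF i] dpar_dirac)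
  then have "trans ?X LTau (dirac ?Y)" by (rule ShhSnd)
  moreover have "scong ?Y (stage (S - {i}) True)"
    using stage_front[OF i, of "S - {i}" True] by (simp add: sender_def Rest_remove sc_sym)
  then have "reaches L y 0" if "scong y ?Y" for y
    using IH that sc_trans by blast
  ultimately have "reaches L X (expect (dirac ?Y) (\<lambda>_. 0))"
    by (intro reaches_scong_step[OF \<open>wf_net X\<close> X]) (auto simp: supp_dirac)
  then show ?thesis by simp
qed

lemma reaches_stage:
  assumes bot: "\<not> has_bot N" and "S \<subseteq> I" "scong X (stage S b)"
  shows "reaches (stage {} True) X (if b then 0 else \<Prod>i\<in>S. 1 - p i)"
proof -
  have "finite S" using assms(2) finite finite_subset by blast
  then show ?thesis using assms(2,3)
  proof (induction S arbitrary: X b)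
    case empty
    have "wf_net X" using scong_wf_net[OF sc_sym[OF empty(2)] wf_stage] .
    \<comment> \<open>With no sender left and no broadcast made, the empty product 1 promises
      nothing.\<close>
    then show ?case using empty reaches_self[OF sc_sym] reaches_trivial by auto
  next
    case (insert i S)
    let ?L = "stage {} True"
    let ?r = "if b then 0 else \<Prod>i\<in>S. 1 - p i"
    have i: "i \<in> I" and S: "S \<subseteq> I" and Si: "insert i S - {i} = S" using insert by auto
    have "wf_net X" using scong_wf_net[OF sc_sym[OF insert.prems(2)] wf_stage] .
    let ?P = "PSnd (Val v) [(1, PNil)]"
    define R where "R = Rest (insert i S) b i"
    define A where "A = Par (Node (m i) ?P (nu (m i))) R"
    define B where "B = Par (Node (m i) PNil (nu (m i))) R"
    let ?\<Theta> = "dpar (cdist (m i) (poplus (p i) ?P PNil) (nu (m i))) (dirac R)"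
    have "scong X (Par (sender (insert i S) i) R)"
      using insert.prems(2) stage_front[OF i] sc_trans unfolding R_def by blast
    then have X: "scong X (Par (Node (m i) (gsnd (Val v) (p i)) (nu (m i))) R)"
      by (simp add: sender_def)
    have step: "trans (Par (Node (m i) (gsnd (Val v) (p i)) (nu (m i))) R) LTau ?\<Theta>"
      unfolding R_def by (intro trans_TauL gsnd_LTau not_has_bot_Rest bot)
    have B: "scong B (stage S b)"
      using stage_front[OF i, of S b] insert.hyps Rest_remove[of "insert i S" i b]
      by (simp add: B_def R_def Si sender_def sc_sym)
    \<comment> \<open>The heads at \<open>m i\<close> differ. Hence \<open>s\<close> below, though
      constant on classes, takes the value 0 at \<open>A\<close> and \<open>?r\<close> at
      \<open>B\<close>.\<close>
    have AB: "\<not> scong B A"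
      by (auto simp: A_def B_def signature_def dest!: scong_signature)
    have reachA: "reaches ?L Y 0" if "scong Y A" for Y
    proof (rule reaches_sent[OF bot i])
      show "scong Y (Par (Node (m i) ?P (nu (m i))) (Rest (insert i S) b i))"
        using that by (simp only: A_def R_def)
      show "reaches ?L Z 0" if "scong Z (stage (insert i S - {i}) True)" for Z
        using insert.IH[OF S, of Z True] that unfolding Si by simp
    qed
    have reachB: "reaches ?L Y ?r" if "scong Y B" for Y
      using insert.IH[OF S sc_trans[OF that B]] .
    define s where "s y = (if scong y A then 0 else ?r)" for y
    have "reaches ?L X (expect ?\<Theta> s)"
    proof (rule reaches_scong_step[OF \<open>wf_net X\<close> X step])
      show "s x = s y" if "scong x y" for x y
        using scong_eqL[OF that, of A] by (simp add: s_def)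
    next
      fix x y assume "y \<in> supp ?\<Theta>" "scong x y"
      then have "y = A \<or> y = B"
        using supp_cdist[of "m i" "poplus (p i) ?P PNil" "nu (m i)"] set_poplus[of "p i" ?P PNil]
        by (fastforce simp: supp_dpar supp_dirac A_def B_def)
      then show "reaches ?L x (s x)"
        using \<open>scong x y\<close> reachA reachB by (auto simp: s_def)
    qed
    moreover have "expect ?\<Theta> s = (1 - p i) * ?r"
      using AB by (simp add: expect_dpar expect_poplus A_def[symmetric] B_def[symmetric]) (simp add: s_def sc_refl)
    ultimately show ?case using insert.hyps by (simp split: if_splits)
  qed
qed

section \<open>The simulation quasimetric\<close>

definition gossip_dist :: "'v net \<Rightarrow> 'v net \<Rightarrow> real" where
  "gossip_dist A B = (if scong A B then 0
    else if scong A (stage {} True) \<and> scong B M then \<Prod>i\<in>I. 1 - p i else 1)"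

lemma gossip_dist_bounds: "0 \<le> gossip_dist A B" "gossip_dist A B \<le> 1"
  using p by (auto simp: gossip_dist_def intro: prod_nonneg prod_le_1)

text \<open>Only summands below 1 matter, where each pair is congruent or exceptional. Congruent
  pairs can be replaced away; for two exceptional pairs in a row, the middle network is congruent to
  both \<open>stage {} True\<close> and \<open>M\<close>, so the end points are congruent
  too.\<close>

lemma gossip_dist_triangle: "gossip_dist A B \<le> gossip_dist A C + gossip_dist C B"
proof (cases "gossip_dist A C < 1 \<and> gossip_dist C B < 1")
  case True
  have AC: "scong A C \<or> scong A (stage {} True) \<and> scong C M"
    using True by (auto simp: gossip_dist_def split: if_splits)
  have CB: "scong C B \<or> scong C (stage {} True) \<and> scong B M"
    using True by (auto simp: gossip_dist_def split: if_splits)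
  consider "scong A C" | "scong C B" | "scong A (stage {} True)" "scong C M" "scong C (stage {} True)" "scong B M"
    using AC CB by blast
  then show ?thesis
  proof cases
    case 1
    then have "gossip_dist A B = gossip_dist C B" by (simp add: gossip_dist_def scong_eqL[OF 1])
    then show ?thesis using gossip_dist_bounds(1)[of A C] by simp
  next
    case 2
    have "scong A C = scong A B"
      using sc_trans[OF _ 2, of A] sc_trans[OF _ sc_sym[OF 2], of A] by (rule iffI)
    then have "gossip_dist A B = gossip_dist A C" by (simp add: gossip_dist_def scong_eqL[OF 2])
    then show ?thesis using gossip_dist_bounds(1)[of C B] by simp
  next
    case 3
    have "scong A B"
      using sc_trans[OF sc_trans[OF 3(1) sc_sym[OF 3(3)]] sc_trans[OF 3(2) sc_sym[OF 3(4)]]] .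
    then show ?thesis using gossip_dist_bounds(1)[of A C] gossip_dist_bounds(1)[of C B] by (simp add: gossip_dist_def[of A B])
  qed
next
  case False
  then show ?thesis using gossip_dist_bounds(1)[of A C] gossip_dist_bounds(1)[of C B] gossip_dist_bounds(2)[of A B] by linarith
qed

lemma weak_sim_gossip_dist: "weak_sim_qmet gossip_dist"
  unfolding weak_sim_qmet_def
proof (intro conjI ballI impI allI)
  show "pseudoquasimetric gossip_dist"
    unfolding pseudoquasimetric_def using gossip_dist_bounds gossip_dist_triangle by (auto simp: gossip_dist_def sc_refl)
  fix A B a \<Delta>
  assume "A \<in> Nets" "B \<in> Nets" and lt: "gossip_dist A B < 1" and A: "trans A a \<Delta>"
  then have wf: "wf_net A" "wf_net B" by (auto simp: Nets_def)
  have "\<exists>s. gossip_dist A B = s \<and> reaches A B s"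
  proof (cases "scong A B")
    case True
    then show ?thesis using reaches_self wf by (auto simp: gossip_dist_def)
  next
    case False
    then have s: "scong A (stage {} True)" "scong B M" "gossip_dist A B = (\<Prod>i\<in>I. 1 - p i)"
      using lt by (auto simp: gossip_dist_def split: if_splits)
    \<comment> \<open>A network that moves contains no \<open>Bot\<close>, which frees
      \<open>N\<close> of it and lets the senders take their silent steps. If the left network
      contains \<open>Bot\<close>, there is no move to match.\<close>
    have "\<not> has_bot N"
      using has_bot_stuck[OF A] scong_has_bot[OF s(1)] by (simp add: stage_def)
    moreover have "scong B (stage I False)"
      unfolding stage_initial by (rule sc_trans[OF s(2) M])
    ultimately have "reaches (stage {} True) B (gossip_dist A B)"
      using reaches_stage[of I B False] s(3) by simp
    moreover have "scong A y = scong (stage {} True) y" for y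
      by (rule scong_eqL[OF s(1)])
    ultimately show ?thesis by (simp add: reaches_def)
  qed
  then obtain \<Theta> where \<Theta>: "weak_tau (dirac B) \<Theta>" "prob \<Theta>" "\<forall>y\<in>supp \<Theta>. wf_net y"
    "1 - gossip_dist A B \<le> expect \<Theta> (\<lambda>y. if scong A y then 1 else 0)"
    unfolding reaches_def by auto
  obtain \<Psi> where "weak_trans B a \<Psi>"
    "kant gossip_dist \<Delta> (pad_bot \<Psi>) \<le> 1 - expect \<Theta> (\<lambda>y. if scong A y then 1 else 0)"
    using weak_match[OF wf(1) A \<Theta>(1,2) _ refl, of gossip_dist] \<Theta>(3,4) lt gossip_dist_bounds
    by (auto simp: gossip_dist_def)
  then show "\<exists>\<Theta>. weak_trans B a \<Theta> \<and> kant gossip_dist \<Delta> (pad_bot \<Theta>) \<le> gossip_dist A B"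
    using \<Theta>(4) by (intro exI[of _ \<Psi>]) linarith
qed

lemma mqm_le: "mqm (stage {} True) M \<le> (\<Prod>i\<in>I. 1 - p i)"
proof -
  have "mqm (stage {} True) M \<le> gossip_dist (stage {} True) M"
    unfolding mqm_def
  proof (rule cInf_lower)
    show "gossip_dist (stage {} True) M \<in> {d (stage {} True) M |d. weak_sim_qmet d}" using weak_sim_gossip_dist by blast
    show "bdd_below {d (stage {} True) M |d. weak_sim_qmet d}"
      using wfM wf_stage
      by (intro bdd_belowI[of _ 0]) (auto simp: weak_sim_qmet_def pseudoquasimetric_def Nets_def)
  qed
  \<comment> \<open>Only an inequality, because the distance is 0 when the two networks are
    congruent, for instance when \<open>I\<close> and \<open>J\<close> are empty.\<close>
  also have "\<dots> \<le> (\<Prod>i\<in>I. 1 - p i)"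
    using p by (auto simp: gossip_dist_def sc_refl intro: prod_nonneg)
  finally show ?thesis .
qed

end

theorem theorem3p1:
  fixes I J :: "nat set" and v :: 'v and p q :: "nat \<Rightarrow> real"
    and M N :: "'v net" and m n :: "nat \<Rightarrow> nat" and nu :: "nat \<Rightarrow> nat set"
  assumes "finite I" and "finite J" and "I \<inter> J = {}"
    and "\<forall>i\<in>I. 0 \<le> p i \<and> p i \<le> 1"
    and "\<forall>j\<in>J. 0 \<le> q j \<and> q j \<le> 1"
    and "wf_net M"
    and "scong M (Par N (Par (bigpar I (\<lambda>i. Node (m i) (gsnd (Val v) (p i)) (nu (m i))))
                             (bigpar J (\<lambda>j. Node (n j) (gfwd (q j)) (nu (n j))))))"
    and "\<forall>i\<in>I. n ` J \<subseteq> nu (m i) \<and> nu (m i) \<subseteq> nds M"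
    and "\<forall>i\<in>I. \<forall>(k, P, \<mu>) \<in> set (nodelist N). k \<in> nu (m i) \<longrightarrow> \<not> rcv k \<mu> P"
  shows "wsim_approx
           (Par N (Par (bigpar I (\<lambda>i. Node (m i) PNil (nu (m i))))
                       (bigpar J (\<lambda>j. Node (n j) (gresnd (Val v) (q j)) (nu (n j))))))
           (\<Prod>i\<in>I. 1 - p i) M"
proof -
  interpret gossip I J v p q M N m n nu
    by (unfold_locales; fact assms)
  show ?thesis using mqm_le by (simp only: wsim_approx_def stage_final)
qed

end
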